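(* Let $\Theta$ be a minimal L-system (with one-dimensional input-output space $\mathbb C$ and $J=1$) whose main operator $T$ has von Neumann parameter $\kappa$, $0\le\kappa<1$. Then exactly one of the following takes place: (1) $V_\Theta(z)$ belongs to the class $\mathfrak M^Q$ and $\kappa=\frac{|Q|}{\sqrt{Q^2+4}}$ for some real $Q$; (2) $V_\Theta(z)$ belongs to the class $\mathfrak M^Q_{\kappa_0}$ and, for some real $Q$ and $a=\frac{1-\kappa_0}{1+\kappa_0}$, with $b=Q^2+a^2-1$, $$\kappa=\frac{\left(b-2Q^2-\sqrt{b^2+4Q^2}\right)^2-a\left(b-\sqrt{b^2+4Q^2}\right)^2+4Q^2a(a-1)}{\left(b-2Q^2-\sqrt{b^2+4Q^2}\right)^2+a\left(b-\sqrt{b^2+4Q^2}\right)^2+4Q^2a(a+1)}$$ (the expression being understood as its limit as $Q\to0$, namely $\kappa_0$, when $Q=0$); (3) $V_\Theta(z)$ belongs to the class $\mathfrak M^{-1,Q}_{\kappa_0}$ and, for some real $Q$ and $a=\frac{1+\kappa_0}{1-\kappa_0}$, with $b=Q^2+a^2-1$, $$\kappa=\frac{a\left(b+\sqrt{b^2+4Q^2}\right)^2-\left(b-2Q^2+\sqrt{b^2+4Q^2}\right)^2-4Q^2a(a-1)}{\left(b-2Q^2+\sqrt{b^2+4Q^2}\right)^2+a\left(b+\sqrt{b^2+4Q^2}\right)^2+4Q^2a(a+1)}$$ (same convention when $Q=0$). Here $0<\kappa_0<1$, and the values of $Q$ and $\kappa_0$ are determined from the integral representation $V_\Theta(z)=Q+\int_{\mathbb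 R}\left(\frac{1}{\lambda-z}-\frac{\lambda}{1+\lambda^2}\right)d\mu(\lambda)$.
   Context: Function classes: for real $Q$ consider $V(z)=Q+\int_{\mathbb R}\left(\frac{1}{\lambda-z}-\frac{\lambda}{1+\lambda^2}\right)d\mu(\lambda)$ with $\mu$ an infinite Borel measure, $\int_{\mathbb R}\frac{d\mu(\lambda)}{1+\lambda^2}=a<\infty$. Then $V\in\mathfrak M^Q$ if $a=1$; $V\in\mathfrak M^Q_{\kappa_0}$ if $a=\frac{1-\kappa_0}{1+\kappa_0}$; $V\in\mathfrak M^{-1,Q}_{\kappa_0}$ if $a=\frac{1+\kappa_0}{1-\kappa_0}$. (For $Q=0$ these are the unperturbed classes $\mathfrak M$, $\mathfrak M_{\kappa_0}$, $\mathfrak M_{\kappa_0}^{-1}$.) It is known that every L-system impedance function with one-dimensional input-output has such a representation. Rigged space: for a closed densely defined symmetric operator $\dot A$ with deficiency indices $(1,1)$ in a complex Hilbert space $\mathcal H$, let $\mathcal H_+=\mathrm{Dom}(\dot A^* )$ with $(f,g)_+=(f,g)+(\dot A^*f,\dot A^*g)$, and let $\mathcal H_+\subset\mathcal H\subset\mathcal H_-$ be the associated rigged Hilbert space. $[X,Y]$ denotes bounded linear operators. If $\mathbb A\in[\mathcal H_+,\mathcal H_-]$ then $\mathbb A^*\in[\mathcal H_+,\mathcal H_-]$; $\mathrm{Re}\,\mathbb A=(\mathbb A+\mathbb A^* )/2$, $\mathrm{Im}\,\mathbb A=(\mathbb A-\mathbb A^* )/2i$. The quasi-kernel $\hat A$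 of $\mathrm{Re}\,\mathbb A$ is its restriction to $\{f\in\mathcal H_+:\mathrm{Re}\,\mathbb A f\in\mathcal H\}$. L-system: let $T$ be a non-symmetric operator with $\dot A\subset T\subset\dot A^*$, $\rho(T)\ne\emptyset$, $\mathrm{Dom}(\dot A)=\mathrm{Dom}(T)\cap\mathrm{Dom}(T^* )$. A $( * )$-extension of $T$ is $\mathbb A\in[\mathcal H_+,\mathcal H_-]$ with $\dot A\subset T\subset\mathbb A$, $\dot A\subset T^*\subset\mathbb A^*$ such that the quasi-kernel $\hat A$ of $\mathrm{Re}\,\mathbb A$ is self-adjoint in $\mathcal H$. An L-system is $\Theta=\begin{pmatrix}\mathbb A&K&1\\ \mathcal H_+\subset\mathcal H\subset\mathcal H_-&&\mathbb C\end{pmatrix}$ where $\mathbb A$ is a $( * )$-extension of such a $T$ (main operator), $K\in[\mathbb C,\mathcal H_-]$, $\mathrm{Im}\,\mathbb A=KK^*$, $\mathrm{Ran}(K)=\mathrm{Ran}(\mathrm{Im}\,\mathbb A)$. It is minimal if $\dot A$ is prime (no nontrivial reducing subspace on which $\dot A$ induces a self-adjoint operator). Impedance function: $V_\Theta(z)=K^*(\mathrm{Re}\,\mathbb A-zI)^{-1}K$, $z\in\rho(\hat A)$. For normalized $g_\pm\in\mathrm{Ker}(\dot A^*\mp iI)$ the von Neumann parameter $\kappa$ of $T$ is defined by $g_+-\kappa g_-\in\mathrm{Dom}(T)$, $|\kappa|<1$; the phase of $g_-$ is chosen so that $0\le\kappa<1$. *)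

theory Defs
  imports "HOL-Analysis.Analysis"
begin

section \<open>Complex Hilbert spaces\<close>

class complex_vector = real_vector +
  fixes scaleC :: "complex \<Rightarrow> 'a \<Rightarrow> 'a"  (infixr \<open>*\<^sub>C\<close> 75)
  assumes scaleC_add_right: "c *\<^sub>C (x + y) = c *\<^sub>C x + c *\<^sub>C y"
    and scaleC_add_left: "(c + d) *\<^sub>C x = c *\<^sub>C x + d *\<^sub>C x"
    and scaleC_scaleC: "c *\<^sub>C d *\<^sub>C x = (c * d) *\<^sub>C x"
    and scaleC_one: "1 *\<^sub>C x = x"
    and scaleR_scaleC: "r *\<^sub>R x = complex_of_real r *\<^sub>C x"

global_interpretation cvec: vector_space "scaleC :: complex \<Rightarrow> 'a \<Rightarrow> 'a::complex_vector"
  by unfold_locales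
    (simp_all add: scaleC_add_right scaleC_add_left scaleC_scaleC scaleC_one)

instantiation prod :: (complex_vector, complex_vector) complex_vector
begin

definition "scaleC c p = (c *\<^sub>C fst p, c *\<^sub>C snd p)"

instance
  by standard
    (auto simp: scaleC_prod_def scaleC_add_right scaleC_add_left scaleC_scaleC
      scaleC_one scaleR_scaleC scaleR_prod_def)

end

text \<open>The inner product is linear in its first argument.  Positive definiteness follows from
  \<open>norm_eq_sqrt_cinner\<close> and the norm axioms, completeness comes from \<^class>\<open>banach\<close>.\<close>

class complex_hilbert = complex_vector + banach +
  fixes cinner :: "'a \<Rightarrow> 'a \<Rightarrow> complex"
  assumes cinner_commute: "cinner x y = cnj (cinner y x)"
    and cinner_add_left: "cinner (x + y) z = cinner x z + cinner y z"
    and cinner_scaleC_left: "cinner (c *\<^sub>C x) y = c * cinner x y"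
    and norm_eq_sqrt_cinner: "norm x = sqrt (Re (cinner x x))"

section \<open>Unbounded operators\<close>

text \<open>An operator is identified with its graph, so that extension of operators is set
  inclusion and an operator is closed iff its graph is closed.\<close>

type_synonym 'a graph = "('a \<times> 'a) set"

definition linear_op :: "'a::complex_hilbert graph \<Rightarrow> bool"
  where "linear_op G \<longleftrightarrow> cvec.subspace G \<and> single_valued G"

definition op_app :: "'a graph \<Rightarrow> 'a \<Rightarrow> 'a"
  where "op_app G f = (THE u. (f, u) \<in> G)"

text \<open>Adjoint of an operator acting in the closed subspace \<open>M\<close>, taken in the Hilbert
  space \<open>M\<close>.\<close>

definition adjoint_in :: "'a::complex_hilbert set \<Rightarrow> 'a graph \<Rightarrow> 'a graph"
  where "adjoint_in M G =
    {(g, h). g \<in> M \<and> h \<in> M \<and> (\<forall>(f, u) \<in> G. cinner u g = cinner f h)}"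

definition self_adjoint_in :: "'a::complex_hilbert set \<Rightarrow> 'a graph \<Rightarrow> bool"
  where "self_adjoint_in M G \<longleftrightarrow>
    linear_op G \<and> G \<subseteq> M \<times> M \<and> M \<subseteq> closure (Domain G) \<and> adjoint_in M G = G"

abbreviation adj :: "'a::complex_hilbert graph \<Rightarrow> 'a graph"
  where "adj G \<equiv> adjoint_in UNIV G"

definition symmetric_op :: "'a::complex_hilbert graph \<Rightarrow> bool"
  where "symmetric_op G \<longleftrightarrow> linear_op G \<and> G \<subseteq> adj G"

definition densely_defined :: "'a::complex_hilbert graph \<Rightarrow> bool"
  where "densely_defined G \<longleftrightarrow> closure (Domain G) = UNIV"

definition resolvent_set :: "'a::complex_hilbert graph \<Rightarrow> complex set"
  where "resolvent_set G =
    {z. (\<forall>h. \<exists>!f. (f, h + z *\<^sub>C f) \<in> G) \<and>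
        (\<exists>C. \<forall>(f, u) \<in> G. norm f \<le> C * norm (u - z *\<^sub>C f))}"

text \<open>\<open>ker_adj A z\<close> is $\mathrm{Ker}(A^* - zI)$.\<close>

definition ker_adj :: "'a::complex_hilbert graph \<Rightarrow> complex \<Rightarrow> 'a set"
  where "ker_adj A z = {f. (f, z *\<^sub>C f) \<in> adj A}"

definition deficiency_one_one :: "'a::complex_hilbert graph \<Rightarrow> bool"
  where "deficiency_one_one A \<longleftrightarrow>
    cvec.dim (ker_adj A \<i>) = 1 \<and> cvec.dim (ker_adj A (- \<i>)) = 1"

text \<open>\<open>M\<close> reduces \<open>A\<close> if $PA \subseteq AP$ for the orthogonal projection $P$ onto \<open>M\<close>;
  below \<open>f'\<close> and \<open>u'\<close> are $Pf$ and $PAf$.\<close>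

definition reducing_subspace :: "'a::complex_hilbert graph \<Rightarrow> 'a set \<Rightarrow> bool"
  where "reducing_subspace A M \<longleftrightarrow> cvec.subspace M \<and> closed M \<and>
    (\<forall>(f, u) \<in> A. \<exists>f' \<in> M. \<exists>u' \<in> M. (f', u') \<in> A \<and>
      (\<forall>m \<in> M. cinner (f - f') m = 0) \<and> (\<forall>m \<in> M. cinner (u - u') m = 0))"

definition prime_op :: "'a::complex_hilbert graph \<Rightarrow> bool"
  where "prime_op A \<longleftrightarrow>
    \<not> (\<exists>M. M \<noteq> {0} \<and> reducing_subspace A M \<and> self_adjoint_in M (A \<inter> M \<times> M))"

section \<open>Rigged Hilbert space\<close>

definition Hplus :: "'a::complex_hilbert graph \<Rightarrow> 'a set"
  where "Hplus A = Domain (adj A)"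

definition inner_plus :: "'a::complex_hilbert graph \<Rightarrow> 'a \<Rightarrow> 'a \<Rightarrow> complex"
  where "inner_plus A f g = cinner f g + cinner (op_app (adj A) f) (op_app (adj A) g)"

definition norm_plus :: "'a::complex_hilbert graph \<Rightarrow> 'a \<Rightarrow> real"
  where "norm_plus A f = sqrt (Re (inner_plus A f f))"

text \<open>$\mathcal H_-$ consists of the bounded antilinear functionals on $\mathcal H_+$, written
  $g \mapsto (\varphi, g)$; they are set to \<open>0\<close> outside $\mathcal H_+$ so that equality of
  functions is equality in $\mathcal H_-$ and the vector operations are pointwise.\<close>

definition Hminus :: "'a::complex_hilbert graph \<Rightarrow> ('a \<Rightarrow> complex) set"
  where "Hminus A = {\<phi>. (\<forall>g. g \<notin> Hplus A \<longrightarrow> \<phi> g = 0) \<and>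
    (\<forall>f \<in> Hplus A. \<forall>g \<in> Hplus A. \<phi> (f + g) = \<phi> f + \<phi> g) \<and>
    (\<forall>c. \<forall>g \<in> Hplus A. \<phi> (c *\<^sub>C g) = cnj c * \<phi> g) \<and>
    (\<exists>C. \<forall>g \<in> Hplus A. cmod (\<phi> g) \<le> C * norm_plus A g)}"

definition norm_minus :: "'a::complex_hilbert graph \<Rightarrow> ('a \<Rightarrow> complex) \<Rightarrow> real"
  where "norm_minus A \<phi> = (SUP g \<in> {g \<in> Hplus A. norm_plus A g \<le> 1}. cmod (\<phi> g))"

definition embed :: "'a::complex_hilbert graph \<Rightarrow> 'a \<Rightarrow> ('a \<Rightarrow> complex)"
  where "embed A f = (\<lambda>g. if g \<in> Hplus A then cinner f g else 0)"

text \<open>The spaces $[\mathcal H_+, \mathcal H_-]$ and $[\mathbb C, \mathcal H_-]$.\<close>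

definition bounded_plus_minus ::
  "'a::complex_hilbert graph \<Rightarrow> ('a \<Rightarrow> 'a \<Rightarrow> complex) \<Rightarrow> bool"
  where "bounded_plus_minus A X \<longleftrightarrow>
    (\<forall>f \<in> Hplus A. X f \<in> Hminus A) \<and>
    (\<forall>f \<in> Hplus A. \<forall>g \<in> Hplus A. X (f + g) = (\<lambda>h. X f h + X g h)) \<and>
    (\<forall>c. \<forall>f \<in> Hplus A. X (c *\<^sub>C f) = (\<lambda>h. c * X f h)) \<and>
    (\<exists>C. \<forall>f \<in> Hplus A. norm_minus A (X f) \<le> C * norm_plus A f)"

definition bounded_complex_minus ::
  "'a::complex_hilbert graph \<Rightarrow> (complex \<Rightarrow> 'a \<Rightarrow> complex) \<Rightarrow> bool"
  where "bounded_complex_minus A K \<longleftrightarrow>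
    (\<forall>c. K c \<in> Hminus A) \<and>
    (\<forall>c d. K (c + d) = (\<lambda>h. K c h + K d h)) \<and>
    (\<forall>c d. K (c * d) = (\<lambda>h. c * K d h)) \<and>
    (\<exists>C. \<forall>c. norm_minus A (K c) \<le> C * cmod c)"

text \<open>The adjoints are determined by $(\mathbb A f, g) = (f, \mathbb A^* g)$ for
  $f, g \in \mathcal H_+$, and by $(Kc, f) = c\,\overline{K^* f}$ for $c \in \mathbb C$,
  $f \in \mathcal H_+$.\<close>

definition adj_pm ::
  "'a::complex_hilbert graph \<Rightarrow> ('a \<Rightarrow> 'a \<Rightarrow> complex) \<Rightarrow> 'a \<Rightarrow> 'a \<Rightarrow> complex"
  where "adj_pm A X g = (\<lambda>f. if f \<in> Hplus A then cnj (X f g) else 0)"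

definition Kadj :: "(complex \<Rightarrow> 'a \<Rightarrow> complex) \<Rightarrow> 'a \<Rightarrow> complex"
  where "Kadj K f = cnj (K 1 f)"

definition Re_pm ::
  "'a::complex_hilbert graph \<Rightarrow> ('a \<Rightarrow> 'a \<Rightarrow> complex) \<Rightarrow> 'a \<Rightarrow> 'a \<Rightarrow> complex"
  where "Re_pm A X f = (\<lambda>g. (X f g + adj_pm A X f g) / 2)"

definition Im_pm ::
  "'a::complex_hilbert graph \<Rightarrow> ('a \<Rightarrow> 'a \<Rightarrow> complex) \<Rightarrow> 'a \<Rightarrow> 'a \<Rightarrow> complex"
  where "Im_pm A X f = (\<lambda>g. (X f g - adj_pm A X f g) / (2 * \<i>))"

definition quasi_kernel ::
  "'a::complex_hilbert graph \<Rightarrow> ('a \<Rightarrow> 'a \<Rightarrow> complex) \<Rightarrow> 'a graph"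
  where "quasi_kernel A X = {(f, u). f \<in> Hplus A \<and> X f = embed A u}"

section \<open>L-systems\<close>

definition main_operator :: "'a::complex_hilbert graph \<Rightarrow> 'a graph \<Rightarrow> bool"
  where "main_operator A T \<longleftrightarrow>
    linear_op T \<and> \<not> symmetric_op T \<and> A \<subseteq> T \<and> T \<subseteq> adj A \<and>
    resolvent_set T \<noteq> {} \<and> Domain A = Domain T \<inter> Domain (adj T)"

definition star_extension ::
  "'a::complex_hilbert graph \<Rightarrow> 'a graph \<Rightarrow> ('a \<Rightarrow> 'a \<Rightarrow> complex) \<Rightarrow> bool"
  where "star_extension A T X \<longleftrightarrow>
    bounded_plus_minus A X \<and>
    A \<subseteq> T \<and> (\<forall>(f, u) \<in> T. X f = embed A u) \<and>
    A \<subseteq> adj T \<and> (\<forall>(f, u) \<in> adj T. adj_pm A X f = embed A u) \<and>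
    self_adjoint_in UNIV (quasi_kernel A (Re_pm A X))"

definition L_system ::
  "'a::complex_hilbert graph \<Rightarrow> 'a graph \<Rightarrow> ('a \<Rightarrow> 'a \<Rightarrow> complex)
    \<Rightarrow> (complex \<Rightarrow> 'a \<Rightarrow> complex) \<Rightarrow> bool"
  where "L_system A T X K \<longleftrightarrow>
    symmetric_op A \<and> closed A \<and> densely_defined A \<and> deficiency_one_one A \<and>
    main_operator A T \<and> star_extension A T X \<and>
    bounded_complex_minus A K \<and>
    (\<forall>f \<in> Hplus A. Im_pm A X f = K (Kadj K f)) \<and>
    range K = Im_pm A X ` Hplus A"

definition minimal_L_system ::
  "'a::complex_hilbert graph \<Rightarrow> 'a graph \<Rightarrow> ('a \<Rightarrow> 'a \<Rightarrow> complex)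
    \<Rightarrow> (complex \<Rightarrow> 'a \<Rightarrow> complex) \<Rightarrow> bool"
  where "minimal_L_system A T X K \<longleftrightarrow> L_system A T X K \<and> prime_op A"

text \<open>The operator $V_\Theta(z) = K^*(\mathrm{Re}\,\mathbb A - zI)^{-1}K$ on $\mathbb C$ is
  identified with its value at \<open>1\<close>.  It is meaningful for \<open>z\<close> in the resolvent set of the
  quasi-kernel of $\mathrm{Re}\,\mathbb A$: there $\mathrm{Re}\,\mathbb A - zI$ is injective on
  $\mathcal H_+$ and its range contains that of $K$.\<close>

definition impedance ::
  "'a::complex_hilbert graph \<Rightarrow> ('a \<Rightarrow> 'a \<Rightarrow> complex)
    \<Rightarrow> (complex \<Rightarrow> 'a \<Rightarrow> complex) \<Rightarrow> complex \<Rightarrow> complex"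
  where "impedance A X K z =
    Kadj K (the_inv_into (Hplus A) (\<lambda>f g. Re_pm A X f g - z * embed A f g) (K 1))"

definition von_Neumann_parameter ::
  "'a::complex_hilbert graph \<Rightarrow> 'a graph \<Rightarrow> complex \<Rightarrow> bool"
  where "von_Neumann_parameter A T \<kappa> \<longleftrightarrow> cmod \<kappa> < 1 \<and>
    (\<exists>gp \<in> ker_adj A \<i>. \<exists>gm \<in> ker_adj A (- \<i>).
      norm gp = 1 \<and> norm gm = 1 \<and> gp - \<kappa> *\<^sub>C gm \<in> Domain T)"

section \<open>Classes of Herglotz--Nevanlinna functions\<close>

text \<open>Functions of these classes live on $\mathbb C \setminus \mathbb R$; only their values
  there matter.\<close>

definition representing_measure :: "real \<Rightarrow> real \<Rightarrow> (complex \<Rightarrow> complex) \<Rightarrow> real measure \<Rightarrow> bool"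
  where "representing_measure Q a V \<mu> \<longleftrightarrow>
    sets \<mu> = sets borel \<and> emeasure \<mu> UNIV = \<infinity> \<and>
    has_bochner_integral \<mu> (\<lambda>t. 1 / (1 + t\<^sup>2)) a \<and>
    (\<forall>z. Im z \<noteq> 0 \<longrightarrow>
      V z = complex_of_real Q +
        (LINT t|\<mu>. 1 / (complex_of_real t - z) - complex_of_real (t / (1 + t\<^sup>2))))"

definition class_M :: "real \<Rightarrow> (complex \<Rightarrow> complex) set"
  where "class_M Q = {V. \<exists>\<mu>. representing_measure Q 1 V \<mu>}"

definition class_M_kappa :: "real \<Rightarrow> real \<Rightarrow> (complex \<Rightarrow> complex) set"
  where "class_M_kappa \<kappa>\<^sub>0 Q =
    {V. \<exists>\<mu>. representing_measure Q ((1 - \<kappa>\<^sub>0) / (1 + \<kappa>\<^sub>0)) V \<mu>}"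

definition class_M_kappa_inv :: "real \<Rightarrow> real \<Rightarrow> (complex \<Rightarrow> complex) set"
  where "class_M_kappa_inv \<kappa>\<^sub>0 Q =
    {V. \<exists>\<mu>. representing_measure Q ((1 + \<kappa>\<^sub>0) / (1 - \<kappa>\<^sub>0)) V \<mu>}"

end

(* Write L for the functional K^*, R for Re A and G for the quasi-kernel of R.  For nonreal z the
   equation R f - z f = K 1 has a unique solution f_z in H_+: a vector t in Dom T with L t = i is
   corrected by the resolvent of G.  Then f_z spans Ker(A^* - z), V(z) = L f_z, and hermiticity of R
   gives V(z) - cnj V(w) = (z - cnj w) (f_z, f_w), while (f_z - f_w, z f_z - w f_w) lies in G.

   With U the Cayley transform of G, w = (z - i)/(z + i) and V(i) = Q + i a, this makes V a power
   series in w with the coefficients (U^k f_i, f_i).  Herglotz' theorem represents them as moments of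
   a measure on the unit circle, which has no mass at 1 by the mean ergodic theorem; transported to
   the line it represents V, with the integral of 1/(1 + t^2) equal to a.  If that measure were
   finite, L would be bounded on Dom G for the norm of H, hence zero.

   A vector g_+ - kappa g_- in Dom T, expressed through f_i and f_{-i}, forces
   kappa^2 = ((1 - a)^2 + Q^2) / ((1 + a)^2 + Q^2), which is the formula of the case a = 1, a < 1 or
   a > 1; these are exclusive because V(i) determines Q and a. *)

theory Submission
  imports Defs "HOL-Probability.Probability"
begin

section \<open>Complex Hilbert spaces\<close>

text \<open>Only the spectral measure of G at the single vector f_i matters, so a scalar moment
  problem stands in for the spectral theorem. A mass at the point 1 of the circle would sit at
  infinity on the line and contribute a multiple of z to V, a term foreign to the three classes;
  density of Dom G excludes it. The decisive facts about L are that it vanishes on the dense set Dom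
  A and yet not on all of Dom G: otherwise T would lie in \<open>adj G = G\<close> and be symmetric.
  A functional bounded for the norm of H cannot do both. The unit vectors g_+ and g_- are determined
  only up to phases, so the relation between kappa and V(i) survives only as an equality of moduli;
  this is why kappa squared appears, and kappa >= 0 selects the root.\<close>

lemma cinner_add_right: "cinner x (y + z) = cinner x y + cinner x (z::'a::complex_hilbert)"
  by (metis cinner_add_left cinner_commute complex_cnj_add)

lemma cinner_scaleC_right: "cinner x (c *\<^sub>C y) = cnj c * cinner x (y::'a::complex_hilbert)"
  by (metis cinner_commute cinner_scaleC_left complex_cnj_mult)

lemma cinner_zero_left [simp]: "cinner 0 (y::'a::complex_hilbert) = 0"
  using cinner_add_left[of 0 0 y] by simp

lemma cinner_zero_right [simp]: "cinner (y::'a::complex_hilbert) 0 = 0"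
  using cinner_add_right[of y 0 0] by simp

lemma cinner_minus_left: "cinner (- x) (y::'a::complex_hilbert) = - cinner x y"
  using cinner_add_left[of x "-x" y] by (simp add: eq_neg_iff_add_eq_0 add.commute)

lemma cinner_minus_right: "cinner y (- x::'a::complex_hilbert) = - cinner y x"
  using cinner_add_right[of y x "-x"] by (simp add: eq_neg_iff_add_eq_0 add.commute)

lemma cinner_diff_left: "cinner (x - y) (z::'a::complex_hilbert) = cinner x z - cinner y z"
  using cinner_add_left[of x "-y" z] by (simp add: cinner_minus_left)

lemma cinner_diff_right: "cinner z (x - y::'a::complex_hilbert) = cinner z x - cinner z y"
  using cinner_add_right[of z x "-y"] by (simp add: cinner_minus_right)

lemmas cinner_simps = cinner_add_left cinner_add_right cinner_diff_left cinner_diff_right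
  cinner_minus_left cinner_minus_right cinner_scaleC_left cinner_scaleC_right

lemma cinner_sum_left: "cinner (sum f S) (y::'a::complex_hilbert) = (\<Sum>i\<in>S. cinner (f i) y)"
  by (induction S rule: infinite_finite_induct) (auto simp: cinner_add_left)

lemma cinner_sum_right: "cinner y (sum f S :: 'a::complex_hilbert) = (\<Sum>i\<in>S. cinner y (f i))"
  by (induction S rule: infinite_finite_induct) (auto simp: cinner_add_right)

lemma cinner_self: "cinner x (x::'a::complex_hilbert) = of_real ((norm x)\<^sup>2)"
proof -
  have re: "Re (cinner x x) = (norm x)\<^sup>2"
    using norm_eq_sqrt_cinner[of x] norm_ge_zero[of x]
    by (metis abs_of_nonneg real_sqrt_abs real_sqrt_eq_iff real_sqrt_ge_0_iff)
  have "Im (cinner x x) = 0"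
    using cinner_commute[of x x] by (simp add: complex_eq_iff)
  with re show ?thesis by (simp add: complex_eq_iff)
qed

lemma cinner_self_eq_0: "cinner x (x::'a::complex_hilbert) = 0 \<longleftrightarrow> x = 0"
  by (simp add: cinner_self)

lemma norm_scaleC: "norm (c *\<^sub>C (x::'a::complex_hilbert)) = cmod c * norm x"
proof -
  have "complex_of_real ((norm (c *\<^sub>C x))\<^sup>2) = (c * cnj c) * cinner x x"
    using cinner_self[of "c *\<^sub>C x"] by (simp add: cinner_simps ac_simps)
  also have "\<dots> = of_real ((cmod c * norm x)\<^sup>2)"
    by (simp add: cinner_self power_mult_distrib flip: complex_norm_square)
  finally have "(norm (c *\<^sub>C x))\<^sup>2 = (cmod c * norm x)\<^sup>2"
    by (simp only: of_real_eq_iff)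
  thus ?thesis by (simp add: power2_eq_iff_nonneg)
qed

lemma norm_add_square: "(norm (x + y))\<^sup>2 =
  (norm x)\<^sup>2 + 2 * Re (cinner x y) + (norm (y::'a::complex_hilbert))\<^sup>2"
proof -
  have "cinner (x+y) (x+y) = cinner x x + cinner x y + cnj (cinner x y) + cinner y y"
    by (simp add: cinner_simps flip: cinner_commute)
  from arg_cong[OF this, of Re] show ?thesis by (simp add: cinner_self)
qed

text \<open>The triangle inequality is an axiom of the norm here, so Cauchy-Schwarz is read off from
  its square instead of preceding it.\<close>

lemma Re_cinner_le: "Re (cinner x y) \<le> norm x * norm (y::'a::complex_hilbert)"
proof -
  have "(norm (x + y))\<^sup>2 \<le> (norm x + norm y)\<^sup>2"
    by (simp add: norm_triangle_ineq power_mono)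
  thus ?thesis by (simp add: norm_add_square power2_sum)
qed

lemma cmod_cinner_le: "cmod (cinner x y) \<le> norm x * norm (y::'a::complex_hilbert)"
proof (cases "cinner x y = 0")
  case False
  \<comment> \<open>A phase that rotates the inner product onto the nonnegative reals, reducing the
    claim to the bound on real parts.\<close>
  define c where "c = cnj (cinner x y) / of_real (cmod (cinner x y))"
  have c: "cmod c = 1" using False by (simp add: c_def norm_divide)
  have "c * cinner x y = of_real (cmod (cinner x y))"
    using False by (simp add: c_def mult.commute power2_eq_square flip: complex_norm_square)
  hence "Re (cinner (c *\<^sub>C x) y) = cmod (cinner x y)"
    by (simp add: cinner_simps)
  with Re_cinner_le[of "c *\<^sub>C x" y] c show ?thesis by (simp add: norm_scaleC)
qed simp

lemma bounded_linear_cinner_left: "bounded_linear (\<lambda>x. cinner x (y::'a::complex_hilbert))"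
  by (rule bounded_linear_intro[where K = "norm y"])
     (simp_all add: cinner_simps scaleR_scaleC cmod_cinner_le scaleR_conv_of_real)

lemma bounded_linear_cinner_right: "bounded_linear (\<lambda>x. cinner (y::'a::complex_hilbert) x)"
  by (rule bounded_linear_intro[where K = "norm y"])
     (simp_all add: cinner_simps scaleR_scaleC scaleR_conv_of_real
       cmod_cinner_le[THEN order_trans[OF _ eq_refl[OF mult.commute]]])

section \<open>Orthogonal complements of closed subspaces\<close>

lemma parallelogram: "(norm (x + y))\<^sup>2 + (norm (x - y))\<^sup>2 =
  2 * (norm x)\<^sup>2 + 2 * (norm (y::'a::complex_hilbert))\<^sup>2"
  using norm_add_square[of x y] norm_add_square[of x "-y"] by (simp add: cinner_simps)

text \<open>The distance to a point outside of the subspace is attained, because by the parallelogram law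
  minimizing sequences are Cauchy.\<close>

lemma exists_orthogonal:
  fixes M :: "'a::complex_hilbert set"
  assumes sub: "cvec.subspace M" and cl: "closed M" and ne: "M \<noteq> UNIV"
  obtains e where "e \<noteq> 0" "\<And>m. m \<in> M \<Longrightarrow> cinner m e = 0"
proof -
  obtain x where x: "x \<notin> M" using ne by auto
  have M0: "0 \<in> M" using sub by (rule cvec.subspace_0)
  define d where "d = infdist x M"
  have d_le: "d \<le> norm (x - m)" if "m \<in> M" for m
    using infdist_le[OF that, of x] by (simp add: d_def dist_norm)
  have d0: "d \<ge> 0" by (simp add: d_def infdist_nonneg)
  have "\<exists>m\<in>M. norm (x - m) < d + 1 / Suc n" for n
  proof (rule ccontr)
    assume "\<not> ?thesis"
    hence "d + 1 / Suc n \<le> infdist x M"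
      using M0 by (auto simp: infdist_def dist_norm not_less intro!: cINF_greatest)
    thus False by (simp add: d_def)
  qed
  then obtain m where m: "\<And>n. m n \<in> M" "\<And>n. norm (x - m n) < d + 1 / Suc n"
    by metis
  have mid: "norm (m i - m j) ^ 2 \<le>
    2 * ((2 * d + 1) * (1 / Suc i)) + 2 * ((2 * d + 1) * (1 / Suc j))" for i j
  proof -
    \<comment> \<open>The midpoint lies in \<open>M\<close>, so the sum of the two differences has
      norm at least \<open>2 * d\<close>; the parallelogram law then makes \<open>m i - m j\<close>
      small.\<close>
    have "(1/2) *\<^sub>C (m i + m j) \<in> M"
      using m sub by (meson cvec.subspace_add cvec.subspace_scale)
    from d_le[OF this] have "2 * d \<le> norm (2 *\<^sub>C (x - (1/2) *\<^sub>C (m i + m j)))"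
      by (simp add: norm_scaleC)
    also have "2 *\<^sub>C (x - (1/2) *\<^sub>C (m i + m j)) = (x - m i) + (x - m j)"
      using scaleC_add_left[of 1 1 x]
      by (simp add: cvec.scale_right_diff_distrib scaleC_scaleC scaleC_one)
    finally have 1: "(2*d)^2 \<le> (norm ((x - m i) + (x - m j)))\<^sup>2"
      using d0 by (intro power_mono) auto
    have sq: "(norm (x - m k))\<^sup>2 \<le> d^2 + (2*d+1) * (1 / Suc k)" for k
    proof -
      have "(norm (x - m k))\<^sup>2 \<le> (d + 1 / Suc k)^2"
        using less_imp_le[OF m(2)[of k]] by (intro power_mono) auto
      also have "\<dots> = d^2 + 2*d*(1/Suc k) + (1/Suc k) * (1/Suc k)"
        by (simp add: power2_eq_square algebra_simps del: of_nat_Suc)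
      also have "(1/Suc k) * (1/Suc k) \<le> 1 * (1/ real (Suc k))"
        by (intro mult_right_mono) auto
      finally show ?thesis by (simp add: algebra_simps)
    qed
    have "m j - m i = (x - m i) - (x - m j)" by simp
    hence "(norm (m i - m j))^2 = 2 * (norm (x - m i))^2 + 2 * (norm (x - m j))^2
        - (norm ((x - m i) + (x - m j)))^2"
      using parallelogram[of "x - m i" "x - m j"] by (simp add: norm_minus_commute)
    moreover have "4 * d^2 \<le> (norm ((x - m i) + (x - m j)))\<^sup>2"
      using 1 by (simp add: power_mult_distrib)
    ultimately show ?thesis using sq[of i] sq[of j] by linarith
  qed
  have "Cauchy m"
  proof (rule metric_CauchyI)
    fix e :: real assume e: "e > 0"
    have "(\<lambda>n. 2 * ((2*d+1) * (1 / Suc n))) \<longlonglongrightarrow> 2 * ((2*d+1) * 0)"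
      by (intro tendsto_intros LIMSEQ_inverse_real_of_nat[unfolded inverse_eq_divide])
    hence "eventually (\<lambda>n. 2 * ((2*d+1) * (1 / Suc n)) < e^2 / 2) sequentially"
      using e by (intro order_tendstoD) auto
    then obtain N where N: "\<And>n. n \<ge> N \<Longrightarrow> 2 * ((2*d+1) * (1 / Suc n)) < e^2 / 2"
      by (auto simp: eventually_sequentially)
    show "\<exists>M. \<forall>i\<ge>M. \<forall>j\<ge>M. dist (m i) (m j) < e"
    proof (intro exI[of _ N] allI impI)
      fix i j assume "i \<ge> N" "j \<ge> N"
      hence "(norm (m i - m j))^2 < e^2" using mid[of i j] N[of i] N[of j] by linarith
      thus "dist (m i) (m j) < e" using e by (simp add: dist_norm power_less_imp_less_base)
    qed
  qed
  then obtain p where p: "m \<longlonglongrightarrow> p" using Cauchy_convergent_iff convergent_def by blast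
  have pM: "p \<in> M" using closed_sequentially[OF cl] m(1) p by blast
  have "(\<lambda>n. d + 1 / Suc n) \<longlonglongrightarrow> d + 0"
    by (intro tendsto_intros LIMSEQ_inverse_real_of_nat[unfolded inverse_eq_divide])
  moreover have "(\<lambda>n. norm (x - m n)) \<longlonglongrightarrow> norm (x - p)" by (intro tendsto_intros p)
  ultimately have pd: "norm (x - p) \<le> d"
    using LIMSEQ_le[of _ "norm (x-p)" _ d] less_imp_le[OF m(2)] by fastforce
  have orth: "cinner k (x - p) = 0" if "k \<in> M" for k
  proof (rule ccontr)
    assume ne: "cinner k (x - p) \<noteq> 0"
    hence k0: "k \<noteq> 0" by auto
    define e where "e = x - p"
    \<comment> \<open>Coefficient of the projection of \<open>e\<close> onto \<open>k\<close>:
      subtracting \<open>c *\<^sub>C k\<close> would lower the squared norm of \<open>e\<close> by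
      |c|^2 |k|^2, against minimality.\<close>
    define c where "c = cinner e k / of_real ((norm k)\<^sup>2)"
    have "p + c *\<^sub>C k \<in> M" using pM that sub by (meson cvec.subspace_add cvec.subspace_scale)
    from d_le[OF this] have "norm e \<le> norm (e + (-c) *\<^sub>C k)"
      using pd by (simp add: e_def algebra_simps)
    hence "(norm e)^2 \<le> (norm (e + (-c) *\<^sub>C k))^2" by (intro power_mono) auto
    hence le: "0 \<le> 2 * Re (cinner e ((-c) *\<^sub>C k)) + (cmod c)^2 * (norm k)^2"
      by (simp only: norm_add_square norm_scaleC) (simp add: power_mult_distrib)
    have "cinner e ((-c) *\<^sub>C k) = - of_real ((cmod c)^2 * (norm k)^2)"
    proof -
      have "cinner e k = c * of_real ((norm k)\<^sup>2)" using k0 by (simp add: c_def)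
      thus ?thesis unfolding of_real_mult complex_norm_square by (simp add: cinner_simps)
    qed
    hence "(cmod c)^2 * (norm k)^2 \<le> 0" using le
      by (simp add: mult.commute del: of_real_mult of_real_power)
    hence "c = 0" using k0 by (simp add: mult_le_0_iff)
    hence "cinner e k = 0" using k0 by (simp add: c_def)
    thus False using ne cinner_commute[of k "x-p"] by (simp add: e_def)
  qed
  show ?thesis
  proof (rule that[of "x - p"])
    show "x - p \<noteq> 0" using x pM by auto
  qed (rule orth)
qed

section \<open>Resolvents of self-adjoint operators\<close>

lemma self_adjoint_symmetric:
  assumes "self_adjoint_in UNIV G" "(f, u) \<in> G" "(g, v) \<in> G"
  shows "cinner u g = cinner f v"
proof -
  have "(g, v) \<in> adj G" using assms(1,3) by (simp add: self_adjoint_in_def)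
  thus ?thesis using assms(2) by (auto simp: adjoint_in_def)
qed

lemma subspace_graph_add:
  "cvec.subspace G \<Longrightarrow> (f, u) \<in> G \<Longrightarrow> (g, v) \<in> G \<Longrightarrow> (f + g, u + v) \<in> G"
  using cvec.subspace_add[of G "(f,u)" "(g,v)"] by simp

lemma subspace_graph_diff:
  "cvec.subspace G \<Longrightarrow> (f, u) \<in> G \<Longrightarrow> (g, v) \<in> G \<Longrightarrow> (f - g, u - v) \<in> G"
  using cvec.subspace_diff[of G "(f,u)" "(g,v)"] by simp

lemma subspace_graph_scale:
  "cvec.subspace G \<Longrightarrow> (f, u) \<in> G \<Longrightarrow> (c *\<^sub>C f, c *\<^sub>C u) \<in> G"
  using cvec.subspace_scale[of G "(f,u)" c] by (simp add: scaleC_prod_def)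

lemma bounded_linear_scaleC_right: "bounded_linear (\<lambda>x::'a::complex_hilbert. c *\<^sub>C x)"
  by (rule bounded_linear_intro[where K = "cmod c"])
    (simp_all add: scaleC_add_right scaleR_scaleC scaleC_scaleC norm_scaleC mult.commute)

text \<open>Since (u, f) is real, the imaginary part of (u - z f, f) is - Im z |f|^2; Cauchy-Schwarz
  bounds it.\<close>

lemma norm_scaleC_diff_ge:
  assumes "cinner u f \<in> \<real>"
  shows "\<bar>Im z\<bar> * norm f \<le> norm (u - z *\<^sub>C f)"
proof (cases "f = 0")
  case False
  have "\<bar>Im z\<bar> * (norm f)\<^sup>2 = \<bar>Im (cinner (u - z *\<^sub>C f) f)\<bar>"
    using assms by (simp add: cinner_simps cinner_self complex_is_Real_iff abs_mult flip:
      of_real_power)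
  also have "\<dots> \<le> norm (u - z *\<^sub>C f) * norm f"
    using abs_Im_le_cmod cmod_cinner_le order_trans by blast
  finally have "(\<bar>Im z\<bar> * norm f) * norm f \<le> norm (u - z *\<^sub>C f) * norm f"
    by (simp add: power2_eq_square mult.assoc)
  thus ?thesis using False by simp
qed simp

lemma closed_adj: "closed (adj G)"
proof -
  have "adj G = (\<Inter>(f, u)\<in>G. {p. cinner u (fst p) = cinner f (snd p)})"
    by (auto simp: adjoint_in_def)
  also have "closed \<dots>"
    by (intro closed_INT ballI)
      (auto intro!: closed_Collect_eq continuous_intros
        bounded_linear.continuous_on[OF bounded_linear_cinner_right])
  finally show ?thesis .
qed

lemma subspace_adj: "cvec.subspace (adj G)"
proof (rule cvec.subspaceI)
  show "0 \<in> adj G" by (auto simp: adjoint_in_def zero_prod_def)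
next
  fix x y assume "x \<in> adj G" "y \<in> adj G"
  thus "x + y \<in> adj G" by (auto simp: adjoint_in_def cinner_add_right split: prod.splits)
next
  fix c x assume "x \<in> adj G"
  thus "c *\<^sub>C x \<in> adj G" by (auto simp: adjoint_in_def scaleC_prod_def cinner_scaleC_right)
qed

lemma self_adjoint_bound:
  assumes "self_adjoint_in UNIV G" "(f, u) \<in> G"
  shows "\<bar>Im z\<bar> * norm f \<le> norm (u - z *\<^sub>C f)"
proof (rule norm_scaleC_diff_ge)
  have "cinner u f = cnj (cinner u f)"
    using self_adjoint_symmetric[OF assms(1) assms(2) assms(2)] cinner_commute[of f u] by simp
  thus "cinner u f \<in> \<real>" by (metis Reals_cnj_iff)
qed

text \<open>The lower bound \<open>self_adjoint_bound\<close> gives injectivity of G - z and, as the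
  graph is closed, a closed range. A vector orthogonal to the range is an eigenvector of
  \<open>adj G = G\<close> for \<open>cnj z\<close>, which the same bound forces to be zero.\<close>

lemma self_adjoint_resolvent:
  assumes sa: "self_adjoint_in UNIV G" and z: "Im z \<noteq> 0"
  shows "\<exists>!f. (f, h + z *\<^sub>C f) \<in> G"
proof -
  have lin: "cvec.subspace G" "single_valued G" and ad: "adj G = G"
    using sa by (auto simp: self_adjoint_in_def linear_op_def)
  have inj: "f = g" if "(f, h + z *\<^sub>C f) \<in> G" "(g, h + z *\<^sub>C g) \<in> G" for f g h
  proof -
    have "(f - g, z *\<^sub>C (f - g)) \<in> G"
      using subspace_graph_diff[OF lin(1) that] by (simp add: cvec.scale_right_diff_distrib)
    from self_adjoint_bound[OF sa this, of z] show ?thesis using z by (simp add: mult_le_0_iff)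
  qed
  define N where "N = {u - z *\<^sub>C f | f u. (f, u) \<in> G}"
  have memN: "u - z *\<^sub>C f \<in> N" if "(f, u) \<in> G" for f u using that by (auto simp: N_def)
  have "N = UNIV"
  proof (rule ccontr)
    assume ne: "N \<noteq> UNIV"
    have sub: "cvec.subspace N"
    proof (rule cvec.subspaceI)
      show "0 \<in> N" using memN[of 0 0] cvec.subspace_0[OF lin(1)] by (simp add: zero_prod_def)
      fix x y assume "x \<in> N" "y \<in> N"
      then obtain f u g v where 1: "(f, u) \<in> G" "(g, v) \<in> G" "x = u - z *\<^sub>C f" "y = v - z *\<^sub>C g"
        by (auto simp: N_def)
      have "x + y = (u + v) - z *\<^sub>C (f + g)" by (simp add: 1 cvec.scale_right_distrib)
      thus "x + y \<in> N" using memN[OF subspace_graph_add[OF lin(1) 1(1,2)]] by simp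
    next
      fix c x assume "x \<in> N"
      then obtain f u where 1: "(f, u) \<in> G" "x = u - z *\<^sub>C f" by (auto simp: N_def)
      show "c *\<^sub>C x \<in> N" using memN[OF subspace_graph_scale[OF lin(1) 1(1), of c]] 1(2)
        by (simp add: cvec.scale_right_diff_distrib scaleC_scaleC mult.commute)
    qed
    have "closed N" unfolding closed_sequential_limits
    proof (intro allI impI, elim conjE)
      fix x l assume x: "\<forall>n. x n \<in> N" and l: "x \<longlonglongrightarrow> l"
      then obtain f u where fu: "\<And>n. (f n, u n) \<in> G" "\<And>n. x n = u n - z *\<^sub>C f n"
        unfolding N_def by simp metis
      have d: "\<bar>Im z\<bar> * norm (f m - f n) \<le> norm (x m - x n)" for m n
        using self_adjoint_bound[OF sa subspace_graph_diff[OF lin(1) fu(1)[of m] fu(1)[of n]], of z]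
        by (simp add: fu(2) cvec.scale_right_diff_distrib algebra_simps)
      have cx: "Cauchy x" using l by (rule LIMSEQ_imp_Cauchy)
      have "Cauchy f"
      proof (rule metric_CauchyI)
        fix e :: real assume "e > 0"
        hence "\<bar>Im z\<bar> * e > 0" using z by simp
        then obtain M where M: "\<And>m n. m \<ge> M \<Longrightarrow> n \<ge> M \<Longrightarrow> dist (x m) (x n) < \<bar>Im z\<bar> * e"
          using metric_CauchyD[OF cx] by blast
        have "dist (f m) (f n) < e" if "m \<ge> M" "n \<ge> M" for m n
        proof -
          have "\<bar>Im z\<bar> * norm (f m - f n) < \<bar>Im z\<bar> * e"
            using d[of m n] M[OF that] by (simp add: dist_norm)
          thus ?thesis using z by (simp add: dist_norm)
        qed
        thus "\<exists>M. \<forall>m\<ge>M. \<forall>n\<ge>M. dist (f m) (f n) < e" by blast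
      qed
      then obtain f0 where f0: "f \<longlonglongrightarrow> f0" using Cauchy_convergent_iff convergent_def by blast
      have zc: "(\<lambda>n. z *\<^sub>C f n) \<longlonglongrightarrow> z *\<^sub>C f0"
        by (rule bounded_linear.tendsto[OF bounded_linear_scaleC_right f0])
      have "(\<lambda>n. x n + z *\<^sub>C f n) \<longlonglongrightarrow> l + z *\<^sub>C f0" by (intro tendsto_intros l zc)
      hence "(\<lambda>n. (f n, u n)) \<longlonglongrightarrow> (f0, l + z *\<^sub>C f0)"
        by (intro tendsto_Pair f0) (simp add: fu(2))
      hence "(f0, l + z *\<^sub>C f0) \<in> G"
        by (rule closed_sequentially[OF closed_adj[of G, unfolded ad], rotated]) (rule fu)
      from memN[OF this] show "l \<in> N" by simp
    qed
    then obtain e where e: "e \<noteq> 0" "\<And>m. m \<in> N \<Longrightarrow> cinner m e = 0"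
      using exists_orthogonal[OF sub _ ne] by blast
    have "(e, cnj z *\<^sub>C e) \<in> adj G"
      using e(2)[OF memN] by (auto simp: adjoint_in_def cinner_simps)
    hence "\<bar>Im (cnj z)\<bar> * norm e \<le> 0"
      using self_adjoint_bound[OF sa, of e "cnj z *\<^sub>C e" "cnj z"] by (simp add: ad)
    thus False using z e(1) by (simp add: mult_le_0_iff)
  qed
  hence "h \<in> N" by simp
  then obtain f u where "(f, u) \<in> G" "h = u - z *\<^sub>C f" by (auto simp: N_def)
  hence "(f, h + z *\<^sub>C f) \<in> G" by simp
  with inj show ?thesis by blast
qed

section \<open>The impedance function of an L-system\<close>

lemma orthogonal_dense_eq_0:
  fixes x :: "'a::complex_hilbert"
  assumes "closure D = UNIV" "\<And>h. h \<in> D \<Longrightarrow> cinner h x = 0"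
  shows "x = 0"
proof -
  have "closed {h. cinner h x = 0}"
    by (intro closed_Collect_eq continuous_intros
        bounded_linear.continuous_on[OF bounded_linear_cinner_left])
  hence "closure D \<subseteq> {h. cinner h x = 0}" using assms(2) by (intro closure_minimal) auto
  hence "cinner x x = 0" using assms(1) by auto
  thus ?thesis by (simp add: cinner_self_eq_0)
qed

lemma dim_eq_1_multiple:
  assumes "cvec.dim (S :: 'a::complex_vector set) = 1" "x \<in> S" "x \<noteq> 0" "y \<in> S"
  shows "\<exists>c. y = c *\<^sub>C x"
proof -
  obtain B where B: "S \<subseteq> cvec.span B" "card B = 1"
    using cvec.basis_exists[of S] assms(1) by metis
  then obtain b where "B = {b}" by (auto simp: card_1_singleton_iff)
  with B assms obtain k l where "x = k *\<^sub>C b" "y = l *\<^sub>C b"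
    by (auto simp: cvec.span_singleton) blast
  with assms(3) have "y = (l / k) *\<^sub>C x" by (auto simp: scaleC_scaleC)
  thus ?thesis ..
qed

locale l_system =
  fixes A T :: "'a::complex_hilbert graph"
    and X :: "'a \<Rightarrow> 'a \<Rightarrow> complex"
    and K :: "complex \<Rightarrow> 'a \<Rightarrow> complex"
  assumes L_system: "L_system A T X K"
begin

abbreviation "R \<equiv> Re_pm A X"
abbreviation "G \<equiv> quasi_kernel A R"
abbreviation "L \<equiv> Kadj K"

text \<open>The f_z of the overview, written with the very term inside \<open>impedance\<close> so
  that \<open>impedance_eq\<close> is an unfolding. For nonreal \<open>z\<close>,
  \<open>gamma_rules\<close> shows that the inverse is genuinely attained.\<close>

definition gamma :: "complex \<Rightarrow> 'a"
  where "gamma z = the_inv_into (Hplus A) (\<lambda>f g. R f g - z * embed A f g) (K 1)"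

lemma impedance_eq: "impedance A X K z = L (gamma z)"
  by (simp add: impedance_def gamma_def)

lemma sa: "self_adjoint_in UNIV G"
  using L_system by (simp add: L_system_def star_extension_def)

lemma lin_G: "cvec.subspace G"
  using sa by (simp add: self_adjoint_in_def linear_op_def)

lemma adj_G: "adj G = G"
  using sa by (simp add: self_adjoint_in_def)

lemma dense: "closure (Domain A) = UNIV"
  using L_system by (simp add: L_system_def densely_defined_def)

lemma T_facts: "linear_op T" "\<not> symmetric_op T" "A \<subseteq> T" "T \<subseteq> adj A" "A \<subseteq> adj T"
  using L_system by (simp_all add: L_system_def main_operator_def star_extension_def)

lemma X_T: "(f, u) \<in> T \<Longrightarrow> X f = embed A u"
  and X_adj_T: "(f, u) \<in> adj T \<Longrightarrow> adj_pm A X f = embed A u"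
  using L_system by (auto simp: L_system_def star_extension_def)

lemma subspace_Hplus: "cvec.subspace (Hplus A)"
proof (rule cvec.subspaceI)
  show "0 \<in> Hplus A"
    using cvec.subspace_0[OF subspace_adj[of A]] by (auto simp: Hplus_def zero_prod_def)
next
  fix x y assume "x \<in> Hplus A" "y \<in> Hplus A"
  thus "x + y \<in> Hplus A"
    using subspace_graph_add[OF subspace_adj[of A]] by (fastforce simp: Hplus_def)
next
  fix c x assume "x \<in> Hplus A"
  thus "c *\<^sub>C x \<in> Hplus A"
    using subspace_graph_scale[OF subspace_adj[of A]] by (fastforce simp: Hplus_def)
qed

lemmas Hplus_closed = cvec.subspace_add[OF subspace_Hplus] cvec.subspace_diff[OF subspace_Hplus]
  cvec.subspace_scale[OF subspace_Hplus]

lemma T_Hplus: "(f, u) \<in> T \<Longrightarrow> f \<in> Hplus A"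
  using T_facts(4) by (auto simp: Hplus_def)

lemma G_Hplus: "(f, u) \<in> G \<Longrightarrow> f \<in> Hplus A"
  and R_G: "(f, u) \<in> G \<Longrightarrow> R f = embed A u"
  by (auto simp: quasi_kernel_def)

lemma X_Hminus: "f \<in> Hplus A \<Longrightarrow> X f \<in> Hminus A"
  and X_add: "f \<in> Hplus A \<Longrightarrow> g \<in> Hplus A \<Longrightarrow> X (f + g) = (\<lambda>h. X f h + X g h)"
  and X_scale: "f \<in> Hplus A \<Longrightarrow> X (c *\<^sub>C f) = (\<lambda>h. c * X f h)"
  using L_system by (auto simp: L_system_def star_extension_def bounded_plus_minus_def)

lemma Hminus_rules:
  assumes "\<phi> \<in> Hminus A"
  shows "g \<notin> Hplus A \<Longrightarrow> \<phi> g = 0"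
    and "f \<in> Hplus A \<Longrightarrow> g \<in> Hplus A \<Longrightarrow> \<phi> (f + g) = \<phi> f + \<phi> g"
    and "g \<in> Hplus A \<Longrightarrow> \<phi> (c *\<^sub>C g) = cnj c * \<phi> g"
  using assms by (auto simp: Hminus_def)

lemma K_Hminus: "K c \<in> Hminus A"
  and K_eq: "K c g = c * K 1 g"
proof -
  have *: "K (c * d) = (\<lambda>h. c * K d h)" for c d
    using L_system by (simp add: L_system_def bounded_complex_minus_def)
  show "K c g = c * K 1 g" using fun_cong[OF *[of c 1], of g] unfolding mult_1_right .
  show "K c \<in> Hminus A"
    using L_system by (simp add: L_system_def bounded_complex_minus_def)
qed

lemma K1_eq: "K 1 g = cnj (L g)"
  by (simp add: Kadj_def)

lemma L_add: "f \<in> Hplus A \<Longrightarrow> g \<in> Hplus A \<Longrightarrow> L (f + g) = L f + L g"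
  and L_scale: "f \<in> Hplus A \<Longrightarrow> L (c *\<^sub>C f) = c * L f"
  by (simp_all add: Kadj_def Hminus_rules[OF K_Hminus])

lemma L_diff: "f \<in> Hplus A \<Longrightarrow> g \<in> Hplus A \<Longrightarrow> L (f - g) = L f - L g"
  using L_add[of "f - g" g] by (simp add: Hplus_closed)

text \<open>The imaginary part has rank one, so \<open>X\<close> and its adjoint differ from
  \<open>R\<close> only by a multiple of \<open>K 1\<close>. Everything known about T and its
  adjoint enters through these two formulas.\<close>

lemma X_eq:
  assumes "f \<in> Hplus A"
  shows "X f g = R f g + \<i> * L f * K 1 g" "adj_pm A X f g = R f g - \<i> * L f * K 1 g"
proof -
  have K: "Im_pm A X f = K (L f)" using L_system assms by (simp add: L_system_def)
  have im: "Im_pm A X f g = L f * K 1 g" unfolding K by (rule K_eq)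
  show "X f g = R f g + \<i> * L f * K 1 g" "adj_pm A X f g = R f g - \<i> * L f * K 1 g"
    unfolding mult.assoc im[symmetric] by (simp_all add: Re_pm_def Im_pm_def field_simps)
qed

lemma R_hermitian: "f \<in> Hplus A \<Longrightarrow> g \<in> Hplus A \<Longrightarrow> R f g = cnj (R g f)"
  by (simp add: Re_pm_def adj_pm_def add.commute)

lemma R_add: "f \<in> Hplus A \<Longrightarrow> g \<in> Hplus A \<Longrightarrow> R (f + g) h = R f h + R g h"
  by (simp add: Re_pm_def adj_pm_def X_add Hminus_rules(2)[OF X_Hminus] field_simps)

lemma R_scale: "f \<in> Hplus A \<Longrightarrow> R (c *\<^sub>C f) h = c * R f h"
  by (simp add: Re_pm_def adj_pm_def X_scale Hminus_rules(3)[OF X_Hminus] field_simps)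

lemma R_diff: "f \<in> Hplus A \<Longrightarrow> g \<in> Hplus A \<Longrightarrow> R (f - g) h = R f h - R g h"
  using R_add[of "f - g" g h] by (simp add: Hplus_closed)

lemma embed_add: "embed A (f + g) h = embed A f h + embed A g h"
  and embed_diff: "embed A (f - g) h = embed A f h - embed A g h"
  and embed_scale: "embed A (c *\<^sub>C f) h = c * embed A f h"
  by (simp_all add: embed_def cinner_simps)

lemma embed_in: "h \<in> Hplus A \<Longrightarrow> embed A f h = cinner f h"
  by (simp add: embed_def)

lemma G_I: "f \<in> Hplus A \<Longrightarrow> (\<And>g. R f g = embed A u g) \<Longrightarrow> (f, u) \<in> G"
  by (auto simp: quasi_kernel_def)

text \<open>On A the operator and its adjoint form agree, hence the rank-one term, which enters them
  with opposite signs, vanishes.\<close>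

lemma A_G:
  assumes "(f, u) \<in> A"
  shows "(f, u) \<in> G" "L f = 0"
proof -
  have T: "(f, u) \<in> T" "(f, u) \<in> adj T" using T_facts assms by auto
  note f = T_Hplus[OF T(1)]
  have e: "embed A u g = R f g + \<i> * L f * K 1 g" "embed A u g = R f g - \<i> * L f * K 1 g" for g
    using X_eq[OF f, of g] by (simp_all add: X_T[OF T(1)] X_adj_T[OF T(2)])
  have z: "L f * K 1 g = 0" for g using e[of g] by (simp add: eq_neg_iff_add_eq_0)
  \<comment> \<open>Evaluating at \<open>f\<close> itself gives |L f|^2 = 0.\<close>
  show "L f = 0" using z[of f] by (simp add: K1_eq)
  thus "(f, u) \<in> G" using f e by (intro G_I) auto
qed

section \<open>The functional L does not vanish on Dom T or on Dom G\<close>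

lemma not_T_subset_G: "\<not> T \<subseteq> G"
proof
  assume "T \<subseteq> G"
  hence "T \<subseteq> adj T"
    using self_adjoint_symmetric[OF sa] by (fastforce simp: adjoint_in_def)
  thus False using T_facts by (simp add: symmetric_op_def)
qed

text \<open>With \<open>L t = \<i>\<close> the rank-one term of \<open>X t\<close> is -
  \<open>K 1\<close>, so \<open>R t\<close> equals \<open>K 1\<close> up to the embedded vector
  \<open>u\<close>: the vector \<open>t\<close> solves the equation for \<open>gamma z\<close>
  modulo the Hilbert space.\<close>

lemma exists_T_normalized: obtains t u where "(t, u) \<in> T" "L t = \<i>"
proof -
  have "\<exists>(t, u)\<in>T. L t \<noteq> 0"
  proof (rule ccontr)
    assume "\<not> ?thesis"
    hence z: "L f = 0" if "(f, u) \<in> T" for f u using that by blast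
    have "(f, u) \<in> G" if "(f, u) \<in> T" for f u
      using X_eq(1)[OF T_Hplus[OF that]] z[OF that] X_T[OF that] T_Hplus[OF that]
      by (intro G_I) auto
    thus False using not_T_subset_G by auto
  qed
  then obtain t u where t: "(t, u) \<in> T" "L t \<noteq> 0" by blast
  have "cvec.subspace T" using T_facts(1) by (simp add: linear_op_def)
  with t have "((\<i> / L t) *\<^sub>C t, (\<i> / L t) *\<^sub>C u) \<in> T" by (intro subspace_graph_scale)
  moreover have "L ((\<i> / L t) *\<^sub>C t) = \<i>" using t T_Hplus by (simp add: L_scale)
  ultimately show ?thesis using that by blast
qed

text \<open>If \<open>L\<close> vanished on Dom G, the rank-one term of \<open>X f\<close> would be
  invisible to Dom G, and hermiticity of \<open>R\<close> would place every pair of T in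
  \<open>adj G = G\<close>.\<close>

lemma L_nonzero_on_G: "\<exists>(g, v)\<in>G. L g \<noteq> 0"
proof (rule ccontr)
  assume "\<not> ?thesis"
  hence z: "L g = 0" if "(g, v) \<in> G" for g v using that by blast
  have "T \<subseteq> G"
  proof (rule subrelI)
    fix f u assume T: "(f, u) \<in> T"
    note f = T_Hplus[OF T]
    have "cinner v f = cinner g u" if gv: "(g, v) \<in> G" for g v
    proof -
      note g = G_Hplus[OF gv]
      have "X f g = R f g" using X_eq(1)[OF f, of g] z[OF gv] by (simp add: K1_eq)
      hence "cinner u g = cnj (cinner v f)"
        using R_hermitian[OF f g] f g by (simp add: X_T[OF T] R_G[OF gv] embed_in)
      thus ?thesis by (metis cinner_commute)
    qed
    hence "(f, u) \<in> adj G" by (auto simp: adjoint_in_def)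
    thus "(f, u) \<in> G" by (simp add: adj_G)
  qed
  thus False using not_T_subset_G by simp
qed

section \<open>Deficiency vectors and the kernel identity\<close>

lemma eigen_0:
  assumes "Im z \<noteq> 0" "(d, z *\<^sub>C d) \<in> G"
  shows "d = 0"
  using self_adjoint_bound[OF sa assms(2), of z] assms(1) by (simp add: mult_le_0_iff)

lemma gamma_rules:
  assumes z: "Im z \<noteq> 0"
  shows "gamma z \<in> Hplus A" "R (gamma z) g = z * embed A (gamma z) g + K 1 g"
proof -
  define F where "F = (\<lambda>f g. R f g - z * embed A f g)"
  have inj: "inj_on F (Hplus A)"
  proof (rule inj_onI)
    fix f g assume f: "f \<in> Hplus A" "g \<in> Hplus A" and eq: "F f = F g"
    have "R (f - g) h = embed A (z *\<^sub>C (f - g)) h" for h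
      using fun_cong[OF eq, of h] f by (simp add: F_def R_diff embed_diff embed_scale algebra_simps)
    hence "(f - g, z *\<^sub>C (f - g)) \<in> G" using f by (intro G_I) (auto simp: Hplus_closed)
    from eigen_0[OF z this] show "f = g" by simp
  qed
  obtain t u where t: "(t, u) \<in> T" "L t = \<i>" by (rule exists_T_normalized)
  note tp = T_Hplus[OF t(1)]
  \<comment> \<open>Applied to \<open>t\<close>, R - z leaves the error u - z t, which lies in the
    Hilbert space; the resolvent of \<open>G\<close> removes it.\<close>
  obtain r where r: "(r, (z *\<^sub>C t - u) + z *\<^sub>C r) \<in> G"
    using self_adjoint_resolvent[OF sa z] by blast
  note rp = G_Hplus[OF r]
  have "F (t + r) = K 1"
  proof
    fix g
    have "embed A u g = R t g - K 1 g" using X_eq(1)[OF tp, of g] by (simp add: X_T[OF t(1)] t(2))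
    thus "F (t + r) g = K 1 g"
      using tp rp by (simp add: F_def R_add R_G[OF r] embed_add embed_diff embed_scale
        algebra_simps)
  qed
  moreover have "t + r \<in> Hplus A" using tp rp by (simp add: Hplus_closed)
  ultimately have im: "K 1 \<in> F ` Hplus A" by force
  have g: "gamma z = the_inv_into (Hplus A) F (K 1)" by (simp add: gamma_def F_def)
  show "gamma z \<in> Hplus A" unfolding g by (rule the_inv_into_into[OF inj im subset_refl])
  have "F (gamma z) = K 1" unfolding g by (rule f_the_inv_into_f[OF inj im])
  from fun_cong[OF this, of g] show "R (gamma z) g = z * embed A (gamma z) g + K 1 g"
    by (simp add: F_def algebra_simps)
qed

text \<open>The two copies of \<open>K 1\<close> cancel, so \<open>R\<close> maps the difference
  into the Hilbert space.\<close>

lemma gamma_diff: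
  assumes "Im z \<noteq> 0" "Im w \<noteq> 0"
  shows "(gamma z - gamma w, z *\<^sub>C gamma z - w *\<^sub>C gamma w) \<in> G"
  using assms
  by (intro G_I) (simp_all add: Hplus_closed gamma_rules R_diff embed_diff embed_scale)

text \<open>Evaluate \<open>R (gamma z) (gamma w)\<close> from the equation for
  \<open>gamma z\<close> and, by hermiticity, from the one for \<open>gamma w\<close>.\<close>

lemma impedance_kernel:
  assumes "Im z \<noteq> 0" "Im w \<noteq> 0"
  shows "impedance A X K z - cnj (impedance A X K w) = (z - cnj w) * cinner (gamma z) (gamma w)"
proof -
  note p = gamma_rules(1)[OF assms(1)] gamma_rules(1)[OF assms(2)]
  have "z * cinner (gamma z) (gamma w) + cnj (L (gamma w)) = R (gamma z) (gamma w)"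
    using assms p by (simp add: gamma_rules embed_in K1_eq)
  also have "\<dots> = cnj (R (gamma w) (gamma z))" by (rule R_hermitian[OF p])
  also have "\<dots> = cnj w * cinner (gamma z) (gamma w) + L (gamma z)"
    using assms p by (simp add: gamma_rules embed_in K1_eq flip: cinner_commute)
  finally show ?thesis by (simp add: impedance_eq algebra_simps)
qed

lemma K1_nonzero: "\<exists>g. K 1 g \<noteq> 0"
proof -
  obtain g v where "(g, v) \<in> G" "L g \<noteq> 0" using L_nonzero_on_G by blast
  thus ?thesis by (auto simp: K1_eq)
qed

lemma gamma_nonzero: "Im z \<noteq> 0 \<Longrightarrow> gamma z \<noteq> 0"
proof
  assume z: "Im z \<noteq> 0" and 0: "gamma z = 0"
  have "R 0 g = 0" for g using R_scale[of 0 0 g] cvec.subspace_0[OF subspace_Hplus] by simp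
  hence "K 1 g = 0" for g using gamma_rules(2)[OF z, of g]
    by (simp add: 0 embed_def split: if_splits)
  thus False using K1_nonzero by simp
qed

text \<open>Testing hermiticity against \<open>gamma z\<close> writes \<open>L\<close> on Dom G as
  an inner product with a deficiency vector. On Dom A, where \<open>L\<close> is zero, this is the
  eigenvector equation; for large imaginary \<open>z\<close> it is the basis of the growth
  estimate.\<close>

lemma L_G:
  assumes z: "Im z \<noteq> 0" and h: "(h, v) \<in> G"
  shows "L h = cinner (v - cnj z *\<^sub>C h) (gamma z)"
proof -
  note p = gamma_rules(1)[OF z] G_Hplus[OF h]
  have "cinner v (gamma z) = R h (gamma z)" using p by (simp add: R_G[OF h] embed_in)
  also have "\<dots> = cnj (R (gamma z) h)" using p by (intro R_hermitian)
  also have "\<dots> = cnj z * cinner h (gamma z) + L h"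
    using z p by (simp add: gamma_rules embed_in K1_eq flip: cinner_commute)
  finally show ?thesis by (simp add: cinner_simps)
qed

lemma gamma_ker_adj:
  assumes z: "Im z \<noteq> 0"
  shows "gamma z \<in> ker_adj A z"
proof -
  have "cinner u (gamma z) = cinner h (z *\<^sub>C gamma z)" if "(h, u) \<in> A" for h u
    using L_G[OF z A_G(1)[OF that]] A_G(2)[OF that] by (simp add: cinner_simps)
  thus ?thesis by (auto simp: ker_adj_def adjoint_in_def)
qed

text \<open>Such a decay of the deficiency vectors would make \<open>L\<close> bounded on the domain of \<open>G\<close> for the
  norm of the Hilbert space; as \<open>L\<close> vanishes on the dense domain of \<open>A\<close>, it would be zero.\<close>

lemma gamma_no_decay:
  assumes C: "\<And>y. y > 0 \<Longrightarrow> y * norm (gamma (\<i> * of_real y)) \<le> C"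
  shows False
proof -
  have C0: "C \<ge> 0" using order_trans[OF norm_ge_zero C[of 1, unfolded mult_1]] by simp
  have bound: "cmod (L h) \<le> C * norm h" if h: "(h, v) \<in> G" for h v
  proof (rule field_le_epsilon)
    fix e :: real assume e: "e > 0"
    \<comment> \<open>Large enough that \<open>C * norm v / y\<close> is at most \<open>e\<close>;
      the summand 1 keeps \<open>y\<close> positive when \<open>C * norm v\<close> is zero.\<close>
    define y where "y = C * norm v / e + 1"
    have y: "y > 0" using C0 e by (simp add: y_def add_nonneg_pos)
    define z where "z = \<i> * complex_of_real y"
    have z: "Im z \<noteq> 0" "cmod z = y" using y by (simp_all add: z_def norm_mult)
    have "y * cmod (L h) \<le> y * ((norm v + y * norm h) * norm (gamma z))"
    proof (intro mult_left_mono)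
      have "cmod (L h) \<le> norm (v - cnj z *\<^sub>C h) * norm (gamma z)"
        unfolding L_G[OF z(1) h] by (rule cmod_cinner_le)
      also have "norm (v - cnj z *\<^sub>C h) \<le> norm v + y * norm h"
        using norm_triangle_ineq4[of v "cnj z *\<^sub>C h"] by (simp add: norm_scaleC z)
      finally show "cmod (L h) \<le> (norm v + y * norm h) * norm (gamma z)"
        by (simp add: mult_right_mono)
    qed (use y in simp)
    also have "\<dots> = (norm v + y * norm h) * (y * norm (gamma z))" by simp
    also have "\<dots> \<le> (norm v + y * norm h) * C"
      using C[OF y] y by (intro mult_left_mono) (auto simp: z_def)
    also have "\<dots> = C * norm v + y * (C * norm h)" by (simp add: algebra_simps)
    also have "C * norm v \<le> y * e" using e by (simp add: y_def field_simps)
    finally have "y * cmod (L h) \<le> y * (C * norm h + e)" by (simp add: algebra_simps)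
    thus "cmod (L h) \<le> C * norm h + e" using y by simp
  qed
  obtain h v where h: "(h, v) \<in> G" "L h \<noteq> 0" using L_nonzero_on_G by blast
  \<comment> \<open>Dividing by \<open>C + 1\<close> rather than \<open>C\<close> makes the final
    inequality strict and covers \<open>C = 0\<close>.\<close>
  define e where "e = cmod (L h) / (C + 1)"
  have "e > 0" using h C0 by (simp add: e_def)
  moreover have "h \<in> closure (Domain A)" using dense by simp
  ultimately obtain h' u where h': "(h', u) \<in> A" "norm (h - h') < e"
    unfolding closure_approachable by (auto simp: dist_norm norm_minus_commute)
  note d = subspace_graph_diff[OF lin_G h(1) A_G(1)[OF h'(1)]]
  have "L (h - h') = L h"
    using L_diff[OF G_Hplus[OF h(1)] G_Hplus[OF A_G(1)[OF h'(1)]]] A_G(2)[OF h'(1)] by simp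
  hence "cmod (L h) \<le> C * norm (h - h')" using bound[OF d] by simp
  also have "\<dots> \<le> C * e" using h' C0 by (intro mult_left_mono) auto
  also have "\<dots> < (C + 1) * e" using \<open>e > 0\<close> by simp
  also have "\<dots> = cmod (L h)" using C0 by (simp add: e_def)
  finally show False by simp
qed

section \<open>The von Neumann parameter and the value V(i)\<close>

lemma adj_A_single_valued: "(f, u) \<in> adj A \<Longrightarrow> (f, v) \<in> adj A \<Longrightarrow> u = v"
proof -
  assume a: "(f, u) \<in> adj A" "(f, v) \<in> adj A"
  have "cinner h (u - v) = 0" if h: "h \<in> Domain A" for h
  proof -
    obtain k where k: "(h, k) \<in> A" using h by auto
    have "cinner k f = cinner h u" "cinner k f = cinner h v"
      using a k by (auto simp: adjoint_in_def)
    thus ?thesis by (simp add: cinner_simps)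
  qed
  from orthogonal_dense_eq_0[OF dense this] show "u = v" by simp
qed

text \<open>Both squared norms are Im V(i) by the kernel identity. Equal norms are what makes the
  coefficients of the two unit vectors equal in modulus.\<close>

lemma norm_gamma_minus_i: "norm (gamma (- \<i>)) = norm (gamma \<i>)"
  and impedance_minus_i: "impedance A X K (- \<i>) = cnj (impedance A X K \<i>)"
proof -
  let ?V = "impedance A X K"
  show m: "?V (- \<i>) = cnj (?V \<i>)" using impedance_kernel[of "-\<i>" \<i>] by simp
  have 1: "(norm (gamma \<i>))\<^sup>2 = Im (?V \<i>)"
    using impedance_kernel[of \<i> \<i>] by (simp add: cinner_self complex_eq_iff flip: of_real_power)
  have 2: "(norm (gamma (- \<i>)))\<^sup>2 = Im (?V \<i>)"
    using impedance_kernel[of "-\<i>" "-\<i>"]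
      by (simp add: cinner_self complex_eq_iff m flip: of_real_power)
  show "norm (gamma (- \<i>)) = norm (gamma \<i>)"
    using 1 2 by (metis norm_ge_zero power2_eq_iff_nonneg)
qed

text \<open>Membership of \<open>D\<close> in Dom T prescribes \<open>X D\<close>, while the
  equations for \<open>gamma\<close> compute it up to a multiple of \<open>K 1\<close>. That
  multiple must vanish, which is a linear relation between the coefficients, and its modulus is free
  of the unknown phases.\<close>

lemma von_Neumann_parameter_impedance:
  assumes "von_Neumann_parameter A T \<kappa>"
  shows "cmod (1 + \<i> * impedance A X K \<i>) = cmod \<kappa> * cmod (1 + \<i> * cnj (impedance A X K \<i>))"
proof -
  let ?V = "impedance A X K"
  let ?f = "gamma \<i>" and ?g = "gamma (- \<i>)"
  obtain gp gm where gp: "gp \<in> ker_adj A \<i>" "norm gp =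
    1" and gm: "gm \<in> ker_adj A (- \<i>)" "norm gm = 1"
    and d: "gp - \<kappa> *\<^sub>C gm \<in> Domain T"
    using assms by (auto simp: von_Neumann_parameter_def)
  have df: "cvec.dim (ker_adj A \<i>) = 1" "cvec.dim (ker_adj A (- \<i>)) = 1"
    using L_system by (simp_all add: L_system_def deficiency_one_one_def)
  have k: "?f \<in> ker_adj A \<i>" "?g \<in> ker_adj A (- \<i>)" by (simp_all add: gamma_ker_adj)
  obtain \<alpha> where \<alpha>: "gp = \<alpha> *\<^sub>C ?f"
    using dim_eq_1_multiple[OF df(1) k(1) _ gp(1)] gamma_nonzero[of \<i>] by auto
  obtain \<beta> where \<beta>: "gm = \<beta> *\<^sub>C ?g"
    using dim_eq_1_multiple[OF df(2) k(2) _ gm(1)] gamma_nonzero[of "-\<i>"] by auto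
  have "cmod \<alpha> * norm ?f = cmod \<beta> * norm ?f"
    using gp(2) gm(2) by (simp add: \<alpha> \<beta> norm_scaleC norm_gamma_minus_i)
  hence ab: "cmod \<alpha> = cmod \<beta>" using gamma_nonzero[of \<i>] by simp
  have a0: "\<alpha> \<noteq> 0" using gp(2) by (auto simp: \<alpha>)
  define \<delta> where "\<delta> = \<kappa> * \<beta>"
  define D where "D = \<alpha> *\<^sub>C ?f - \<delta> *\<^sub>C ?g"
  define U where "U = \<alpha> *\<^sub>C (\<i> *\<^sub>C ?f) - \<delta> *\<^sub>C ((- \<i>) *\<^sub>C ?g)"
  have "(D, U) \<in> adj A"
    unfolding D_def U_def using k
    by (intro subspace_graph_diff subspace_graph_scale subspace_adj) (simp_all add: ker_adj_def)
  moreover obtain u where u: "(D, u) \<in> T"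
    using d by (auto simp: D_def \<delta>_def \<alpha> \<beta> scaleC_scaleC)
  \<comment> \<open>T is contained in \<open>adj A\<close>, which is single valued, so the value of
    T at \<open>D\<close> is forced.\<close>
  ultimately have uU: "u = U" using adj_A_single_valued T_facts(4) by blast
  have p: "?f \<in> Hplus A" "?g \<in> Hplus A" by (simp_all add: gamma_rules)
  have Dp: "D \<in> Hplus A" by (simp add: D_def p Hplus_closed)
  have LD: "L D = \<alpha> * ?V \<i> - \<delta> * cnj (?V \<i>)"
    by (simp add: D_def L_diff L_scale Hplus_closed p flip: impedance_eq impedance_minus_i)
  have RD: "R D g = embed A U g + (\<alpha> - \<delta>) * K 1 g" for g
    unfolding D_def U_def embed_diff embed_scale
    by (simp add: R_diff R_scale Hplus_closed p gamma_rules algebra_simps)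
  have "(\<alpha> - \<delta> + \<i> * L D) * K 1 g = 0" for g
    using X_eq(1)[OF Dp, of g] unfolding X_T[OF u] uU RD by (simp add: algebra_simps)
  hence "\<alpha> - \<delta> + \<i> * L D = 0" using K1_nonzero by auto
  hence "\<alpha> * (1 + \<i> * ?V \<i>) = \<kappa> * \<beta> * (1 + \<i> * cnj (?V \<i>))"
    by (simp add: LD \<delta>_def algebra_simps)
  hence "cmod \<alpha> * cmod (1 + \<i> * ?V \<i>) = cmod \<alpha> * (cmod \<kappa> * cmod (1 + \<i> * cnj (?V \<i>)))"
    by (metis ab norm_mult mult.commute mult.left_commute)
  thus ?thesis using a0 by simp
qed

end

section \<open>The trigonometric moment problem\<close>

lemma integral_exp_int_period:
  fixes m :: int
  shows "integrable lborel (\<lambda>t. indicator {0..2 * pi} t *\<^sub>R exp (\<i> * of_int m * complex_of_real t))"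
    and "(LINT t|lborel. indicator {0..2 * pi} t *\<^sub>R exp (\<i> * of_int m * complex_of_real t))
      = (if m = 0 then 2 * pi else 0)"
proof -
  have c: "continuous_on S (\<lambda>t. exp (\<i> * of_int m * complex_of_real t))" for S
    by (intro continuous_intros)
  show "integrable lborel (\<lambda>t. indicator {0..2 * pi} t *\<^sub>R exp (\<i> * of_int m * complex_of_real t))"
    using borel_integrable_atLeastAtMost'[OF c] by (simp add: set_integrable_def)
  show "(LINT t|lborel. indicator {0..2 * pi} t *\<^sub>R exp (\<i> * of_int m * complex_of_real t))
      = (if m = 0 then 2 * pi else 0)"
  proof (cases "m = 0")
    case True
    thus ?thesis
      using integral_FTC_atLeastAtMost[of 0 "2*pi" complex_of_real "\<lambda>_. 1"]
      by (auto intro!: derivative_eq_intros simp: has_vector_derivative_of_real scaleR_conv_of_real)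
  next
    case False
    have F: "((\<lambda>t. exp (\<i> * of_int m * complex_of_real t) / (\<i> * of_int m)) has_vector_derivative
      exp (\<i> * of_int m * complex_of_real t)) (at t within {0..2 * pi})" for t
      using False by (auto intro!: derivative_eq_intros has_vector_derivative_real_field)
    have "exp (\<i> * of_int m * complex_of_real (2 * pi)) = 1"
      by (subst exp_eq_1) (auto intro!: exI[of _ m])
    thus ?thesis using False integral_FTC_atLeastAtMost[OF _ F c] by simp
  qed
qed

lemma shift_invariant_cinner:
  fixes g :: "nat \<Rightarrow> 'a::complex_hilbert"
  assumes "\<And>m n. cinner (g (Suc m)) (g (Suc n)) = cinner (g m) (g n)"
  shows "cinner (g (m + k)) (g (n + k)) = cinner (g m) (g n)"
  by (induction k) (simp_all add: assms)

text \<open>The Gram matrix of \<open>g\<close> is constant along diagonals. Expanding the square,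
  orthogonality of the exponentials keeps the pairs with \<open>k = n + l\<close>, of which there
  are \<open>N - n\<close>; the truncated subtraction correctly gives none for
  \<open>n \<ge> N\<close>.\<close>

lemma integral_fejer:
  fixes g :: "nat \<Rightarrow> 'a::complex_hilbert"
  assumes g: "\<And>m n. cinner (g (Suc m)) (g (Suc n)) = cinner (g m) (g n)"
  defines "s \<equiv> \<lambda>N t. \<Sum>k<N. exp (- \<i> * of_nat k * complex_of_real t) *\<^sub>C g k"
  shows "integrable lborel (\<lambda>t. (indicator {0..2 * pi} t * (norm (s N t))\<^sup>2) *\<^sub>R iexp (real n * t))"
    and "(LINT t|lborel. (indicator {0..2 * pi} t * (norm (s N t))\<^sup>2) *\<^sub>R iexp (real n * t))
      = 2 * pi * real (N - n) * cinner (g n) (g 0)"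
proof -
  define e where "e = (\<lambda>(m::int) t. indicator {0..2 * pi} t *\<^sub>R exp (\<i> * of_int m *
    complex_of_real t))"
  have eq: "(indicator {0..2 * pi} t * (norm (s N t))\<^sup>2) *\<^sub>R iexp (real n * t)
     = (\<Sum>k<N. \<Sum>l<N. cinner (g k) (g l) * e (int n - int k + int l) t)" for t
  proof -
    have "complex_of_real ((norm (s N t))\<^sup>2) = cinner (s N t) (s N t)"
      by (simp add: cinner_self)
    also have "\<dots> =
      (\<Sum>k<N. \<Sum>l<N. cinner (g k) (g l) * exp (\<i> * of_int (- int k + int l) * complex_of_real t))"
      unfolding s_def cinner_sum_left unfolding cinner_sum_right
      by (intro sum.cong refl) (simp add: cinner_simps exp_cnj algebra_simps flip: exp_add)
    finally show ?thesis
      by (simp add: scaleR_conv_of_real sum_distrib_left sum_distrib_right e_def algebra_simps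
          exp_add exp_diff)
  qed
  have ie: "integrable lborel (\<lambda>t. cinner (g k) (g l) * e m t)" for k l m
    unfolding e_def by (intro integrable_mult_right integral_exp_int_period(1))
  show "integrable lborel (\<lambda>t. (indicator {0..2 * pi} t * (norm (s N t))\<^sup>2) *\<^sub>R iexp (real n * t))"
    unfolding eq by (intro Bochner_Integration.integrable_sum ie)
  have "(LINT t|lborel. (indicator {0..2 * pi} t * (norm (s N t))\<^sup>2) *\<^sub>R iexp (real n * t))
    = (\<Sum>k<N. \<Sum>l<N. LINT t|lborel. cinner (g k) (g l) * e (int n - int k + int l) t)"
    unfolding eq by (simp add: Bochner_Integration.integral_sum ie
      Bochner_Integration.integrable_sum)
  also have "\<dots> = (\<Sum>k<N. \<Sum>l<N. if k = n + l then 2 * pi * cinner (g n) (g 0) else 0)"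
  proof (intro sum.cong refl)
    fix k l
    show "(LINT t|lborel. cinner (g k) (g l) * e (int n - int k + int l) t)
      = (if k = n + l then 2 * pi * cinner (g n) (g 0) else 0)"
      unfolding e_def integral_mult_right_zero integral_exp_int_period(2)
      using shift_invariant_cinner[of g n l 0] g by auto
  qed
  also have "\<dots> = (\<Sum>l<N. \<Sum>k<N. if k = n + l then 2 * pi * cinner (g n) (g 0) else 0)"
    by (rule sum.swap)
  also have "\<dots> = (\<Sum>l<N. if l < N - n then 2 * pi * cinner (g n) (g 0) else 0)"
    by (intro sum.cong refl) (auto simp: sum.delta)
  also have "\<dots> = (\<Sum>l<N-n. 2 * pi * cinner (g n) (g 0))"
    by (rule sum.mono_neutral_cong_right) auto
  finally show "(LINT t|lborel. (indicator {0..2 * pi} t * (norm (s N t))\<^sup>2) *\<^sub>R iexp (real n * t))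
      = 2 * pi * real (N - n) * cinner (g n) (g 0)" by simp
qed

text \<open>The measure is a weak limit of the Fejer densities of the sequence of moments.\<close>

lemma herglotz_moments:
  fixes g :: "nat \<Rightarrow> 'a::complex_hilbert"
  assumes g: "\<And>m n. cinner (g (Suc m)) (g (Suc n)) = cinner (g m) (g n)" and g0: "norm (g 0) = 1"
  obtains M where "real_distribution M" "\<And>n. char M (real n) = cinner (g n) (g 0)"
proof -
  define s where "s = (\<lambda>N t. \<Sum>k<N. exp (- \<i> * of_nat k * complex_of_real t) *\<^sub>C g k)"
  \<comment> \<open>\<open>Suc N\<close> keeps the denominator nonzero; as \<open>g 0\<close> is a
    unit vector, the coefficient for n = 0 shows that each density has mass one.\<close>
  define p where "p = (\<lambda>N t. indicator {0..2 * pi} t * (norm (s (Suc N) t))\<^sup>2 / (2 * pi * Suc N))"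
  define M where "M = (\<lambda>N. density lborel (\<lambda>t. ennreal (p N t)))"
  have p0: "p N t \<ge> 0" for N t by (simp add: p_def)
  have s1: "(indicator {0..2 * pi} t * (norm (s N t))\<^sup>2) = 
      Re ((indicator {0..2 * pi} t * (norm (s N t))\<^sup>2) *\<^sub>R iexp (real 0 * t))" for t N
    by simp
  have int1: "integrable lborel (\<lambda>t. indicator {0..2 * pi} t * (norm (s N t))\<^sup>2)" for N
    by (subst s1, unfold s_def) (rule integrable_Re integral_fejer g)+
  have pint: "integrable lborel (p N)" for N
    unfolding p_def by (intro integrable_divide int1)
  have pm [measurable]: "p N \<in> borel_measurable borel" for N
    using borel_measurable_integrable[OF pint[of N]] by simp
  have val: "(LINT t|lborel. p N t *\<^sub>R iexp (real n * t)) =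
    real (Suc N - n) / Suc N * cinner (g n) (g 0)" for N n
  proof -
    have "(LINT t|lborel. p N t *\<^sub>R iexp (real n * t)) =
      (LINT t|lborel. (indicator {0..2 * pi} t * (norm (s (Suc N) t))\<^sup>2) *\<^sub>R iexp (real n * t) /
        (2 * pi * Suc N))"
      by (intro Bochner_Integration.integral_cong) (simp_all add: p_def scaleR_conv_of_real)
    also have "\<dots> = (2 * pi * real (Suc N - n) * cinner (g n) (g 0)) / (2 * pi * Suc N)"
      unfolding integral_divide_zero s_def integral_fejer(2)[of g, OF g] ..
    finally show ?thesis by (simp del: of_nat_Suc)
  qed
  have "(LINT t|lborel. complex_of_real (p N t)) = 1" for N
    using val[of N 0] g0 by (simp add: scaleR_conv_of_real cinner_self del: of_nat_Suc)
  hence "(LINT t|lborel. p N t) = 1" for N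
    by (metis integral_complex_of_real of_real_eq_1_iff)
  hence "(\<integral>\<^sup>+ t. ennreal (p N t) \<partial>lborel) = 1" for N
    by (simp add: nn_integral_eq_integral pint p0)
  hence "prob_space (M N)" for N
    by (intro prob_spaceI) (simp add: M_def emeasure_density)
  hence rd: "real_distribution (M N)" for N
    by (simp add: real_distribution_def real_distribution_axioms_def M_def)
  have ch: "char (M N) (real n) = real (Suc N - n) / Suc N * cinner (g n) (g 0)" for N n
  proof -
    have "char (M N) (real n) = (LINT t|lborel. p N t *\<^sub>R iexp (real n * t))"
      unfolding char_def M_def by (subst integral_density) (simp_all add: p0)
    thus ?thesis by (simp only: val)
  qed
  \<comment> \<open>Tightness speaks of half-open intervals while the densities live on the closed
    interval from 0 to 2 pi, hence the left end -1.\<close>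
  have supp: "measure (M N) {-1<..2*pi} = 1" for N
  proof -
    interpret real_distribution "M N" by (rule rd)
    have "AE x in M N. x \<in> {-1<..2*pi}"
      unfolding M_def using pm by (subst AE_density) (auto, auto simp: p_def indicator_def)
    thus ?thesis by (subst (asm) AE_in_set_eq_1) auto
  qed
  have "tight M"
    unfolding tight_def
  proof (intro conjI allI impI rd)
    fix e :: real assume "e > 0"
    moreover have "-1 < 2 * pi" using pi_gt_zero by linarith
    ultimately show "\<exists>a b. a < b \<and> (\<forall>n. 1 - e < measure (M n) {a<..b})"
      using supp by (intro exI[of _ "-1"] exI[of _ "2*pi"]) simp
  qed
  \<comment> \<open>Helly selection; Levy continuity then carries the moments to the weak limit,
    since their Cesaro factors tend to 1.\<close>
  from tight_imp_convergent_subsubsequence[OF this strict_mono_id]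
  obtain r M' where r: "strict_mono r" "real_distribution M'" "weak_conv_m (\<lambda>n. M (r n)) M'"
    by (auto simp: o_def)
  have "char M' (real n) = cinner (g n) (g 0)" for n
  proof -
    have "(\<lambda>N. char (M (r N)) (real n)) \<longlonglongrightarrow> char M' (real n)"
      using r by (intro levy_continuity1 rd)
    moreover have "(\<lambda>N. char (M N) (real n)) \<longlonglongrightarrow> 1 * cinner (g n) (g 0)"
    proof -
      have "(\<lambda>N. real (Suc N - n) / real (Suc N)) \<longlonglongrightarrow> 1"
      proof (rule Lim_transform_eventually)
        show "(\<lambda>N. 1 - real n * (1 / Suc N)) \<longlonglongrightarrow> 1"
          by (rule tendsto_eq_intros LIMSEQ_inverse_real_of_nat[unfolded inverse_eq_divide] refl)+
            simp
        show "\<forall>\<^sub>F N in sequentially. 1 - real n * (1 / Suc N) = real (Suc N - n) / real (Suc N)"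
          using eventually_ge_at_top[of n] by eventually_elim (simp add: field_simps of_nat_diff)
      qed
      from tendsto_mult[OF tendsto_of_real[OF this, where 'a = complex] tendsto_const]
      show ?thesis unfolding ch of_real_1 .
    qed
    hence "(\<lambda>N. char (M (r N)) (real n)) \<longlonglongrightarrow> cinner (g n) (g 0)"
      using LIMSEQ_subseq_LIMSEQ[OF _ r(1)] by (fastforce simp: o_def)
    ultimately show ?thesis by (rule LIMSEQ_unique)
  qed
  with r(2) that show ?thesis by blast
qed

section \<open>Moments, power series in the disc, and the mass at 1\<close>

lemma cmod_cayley_less_1:
  assumes "Im z > 0"
  shows "cmod ((z - \<i>) / (z + \<i>)) < 1"
proof -
  have "(cmod (z - \<i>))\<^sup>2 < (cmod (z + \<i>))\<^sup>2"
    unfolding cmod_power2 using assms by (simp add: power2_eq_square algebra_simps)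
  hence "cmod (z - \<i>) < cmod (z + \<i>)" by (rule power_less_imp_less_base) simp
  moreover have "z + \<i> \<noteq> 0" using assms by (auto simp: complex_eq_iff)
  ultimately show ?thesis by (simp add: norm_divide)
qed

lemma iexp_power: "iexp (real k * t) = iexp t ^ k"
  by (simp add: exp_of_nat_mult[symmetric] algebra_simps)

lemma (in prob_space) integrable_bounded:
  fixes h :: "'a \<Rightarrow> complex"
  assumes "h \<in> borel_measurable M" "\<And>x. cmod (h x) \<le> B"
  shows "integrable M h"
  using assms by (intro integrable_const_bound[where B = B]) auto

text \<open>Termwise integration of the geometric series, dominated by the constant 1 / (1 -
  |w|).\<close>

lemma char_power_series:
  assumes "real_distribution M" and w: "cmod w < 1"
  shows "(\<lambda>k. w ^ k * char M (real k)) sums (LINT t|M. 1 / (1 - w * iexp t))"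
proof -
  interpret real_distribution M by fact
  have i: "integrable M (\<lambda>t. w ^ k * iexp (real k * t))" for k
    by (intro integrable_bounded[where B = "cmod w ^ k"]) (simp_all add: norm_mult norm_power)
  have "(\<lambda>n. LINT t|M. (\<Sum>k<n. w ^ k * iexp (real k * t))) \<longlonglongrightarrow> (LINT t|M. 1 / (1 - w * iexp t))"
  proof (rule integral_dominated_convergence[where w = "\<lambda>_. 1 / (1 - cmod w)"])
    have n: "norm (w * iexp t) < 1" for t using w by (simp add: norm_mult)
    show "AE t in M. (\<lambda>n. \<Sum>k<n. w ^ k * iexp (real k * t)) \<longlonglongrightarrow> 1 / (1 - w * iexp t)"
      using geometric_sums[OF n]
        by (intro AE_I2) (simp only: sums_def iexp_power power_mult_distrib)
    show "AE t in M. norm (\<Sum>k<n. w ^ k * iexp (real k * t)) \<le> 1 / (1 - cmod w)" for n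
    proof (rule AE_I2)
      fix t
      have "norm (\<Sum>k<n. w ^ k * iexp (real k * t)) \<le> (\<Sum>k<n. cmod w ^ k)"
        by (rule sum_norm_le) (simp add: norm_mult norm_power)
      also have "\<dots> \<le> (\<Sum>k. cmod w ^ k)"
        using w by (intro sum_le_suminf summable_geometric) auto
      also have "\<dots> = 1 / (1 - cmod w)" using w by (intro suminf_geometric) simp
      finally show "norm (\<Sum>k<n. w ^ k * iexp (real k * t)) \<le> 1 / (1 - cmod w)" .
    qed
  qed simp_all
  moreover have "(LINT t|M. (\<Sum>k<n. w ^ k * iexp (real k * t))) =
    (\<Sum>k<n. w ^ k * char M (real k))" for n
    by (subst Bochner_Integration.integral_sum[OF i]) (simp only: char_def integral_mult_right_zero)
  ultimately show ?thesis by (simp only: sums_def)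
qed

text \<open>The averages of the powers of a point u of the circle are bounded by 1 and tend to 1 if
  u = 1 and to 0 otherwise. Hence the averaged moments converge to the mass at 1.\<close>

lemma AE_iexp_neq_1:
  assumes "real_distribution M"
    and lim: "(\<lambda>n. (\<Sum>k<Suc n. char M (real k)) / of_nat (Suc n)) \<longlonglongrightarrow> 0"
  shows "AE t in M. iexp t \<noteq> 1"
proof -
  interpret real_distribution M by fact
  define S where "S = {t. iexp t = 1}"
  have S: "S \<in> sets M" unfolding S_def events_eq_borel
    by (intro borel_closed closed_Collect_eq continuous_intros)
  have i: "integrable M (\<lambda>t. iexp (real k * t))" for k
    by (intro integrable_bounded[where B = 1]) simp_all
  have "(\<lambda>n. LINT t|M. (\<Sum>k<Suc n. iexp (real k * t)) / of_nat (Suc n)) \<longlonglongrightarrow>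
      (LINT t|M. complex_of_real (indicator S t))"
  proof (rule integral_dominated_convergence[where w = "\<lambda>_. 1"])
    show "AE t in M. (\<lambda>n. (\<Sum>k<Suc n. iexp (real k * t)) / of_nat (Suc n)) \<longlonglongrightarrow>
      complex_of_real (indicator S t)"
    proof (rule AE_I2)
      fix t
      show "(\<lambda>n. (\<Sum>k<Suc n. iexp (real k * t)) / of_nat (Suc n)) \<longlonglongrightarrow> complex_of_real (indicator S t)"
      proof (cases "iexp t = 1")
        case True
        thus ?thesis unfolding iexp_power by (simp add: S_def del: of_nat_Suc sum.lessThan_Suc)
      next
        case False
        have b: "norm ((\<Sum>k<Suc n. iexp (real k * t)) / of_nat (Suc n)) \<le>
          2 / norm (iexp t - 1) * (1 / real (Suc n))" for n
        proof -
          have "norm (iexp t ^ Suc n - 1) \<le> norm (iexp t ^ Suc n) + norm (1::complex)"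
            by (rule norm_triangle_ineq4)
          hence "norm (iexp t ^ Suc n - 1) \<le> 2" by (simp add: norm_power norm_mult)
          hence "norm ((iexp t ^ Suc n - 1) / (iexp t - 1)) \<le> 2 / norm (iexp t - 1)"
            unfolding norm_divide by (intro divide_right_mono) auto
          hence "norm ((iexp t ^ Suc n - 1) / (iexp t - 1)) / real (Suc n) \<le>
            2 / norm (iexp t - 1) / real (Suc n)"
            by (intro divide_right_mono) auto
          thus ?thesis
            unfolding iexp_power geometric_sum[OF False] norm_divide[of _ "of_nat (Suc n)"]
              norm_of_nat by simp
        qed
        have "(\<lambda>n. 2 / norm (iexp t - 1) * (1 / real (Suc n))) \<longlonglongrightarrow> 2 / norm (iexp t - 1) * 0"
          by (intro tendsto_intros LIMSEQ_inverse_real_of_nat[unfolded inverse_eq_divide])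
        hence "(\<lambda>n. 2 / norm (iexp t - 1) * (1 / real (Suc n))) \<longlonglongrightarrow> 0" unfolding mult_zero_right .
        hence "(\<lambda>n. (\<Sum>k<Suc n. iexp (real k * t)) / of_nat (Suc n)) \<longlonglongrightarrow> 0"
          by (rule Lim_null_comparison[rotated]) (intro always_eventually allI b)
        thus ?thesis using False by (simp add: S_def)
      qed
    qed
    show "AE t in M. norm ((\<Sum>k<Suc n. iexp (real k * t)) / of_nat (Suc n)) \<le> 1" for n
    proof (rule AE_I2)
      fix t
      have "norm (\<Sum>k<Suc n. iexp (real k * t)) \<le> (\<Sum>k<Suc n. 1)"
        by (rule sum_norm_le) simp
      thus "norm ((\<Sum>k<Suc n. iexp (real k * t)) / of_nat (Suc n)) \<le> 1"
        unfolding norm_divide norm_of_nat by (subst pos_divide_le_eq) simp_all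
    qed
    show "(\<lambda>t. complex_of_real (indicator S t)) \<in> borel_measurable M" using S by measurable
    show "(\<lambda>t. (\<Sum>k<Suc n. iexp (real k * t)) / of_nat (Suc n)) \<in> borel_measurable M" for n
      by measurable
    show "integrable M (\<lambda>_. 1 :: real)" by simp
  qed
  moreover have "(LINT t|M. (\<Sum>k<Suc n. iexp (real k * t)) / of_nat (Suc n)) =
      (\<Sum>k<Suc n. char M (real k)) / of_nat (Suc n)" for n
    unfolding integral_divide_zero
      by (subst Bochner_Integration.integral_sum[OF i]) (simp only: char_def)
  ultimately have "(LINT t|M. complex_of_real (indicator S t)) = 0"
    using LIMSEQ_unique[OF _ lim] by (simp only:)
  hence "measure M S = 0" using S by simp
  hence "AE t in M. t \<notin> S" using prob_eq_0[OF S] by simp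
  thus ?thesis by (simp add: S_def)
qed

text \<open>The inverse of $\lambda \mapsto (\lambda + i)/(\lambda - i)$ on the unit circle is
  $e^{it} \mapsto \cot(t/2)$.\<close>

definition cot_half :: "real \<Rightarrow> real"
  where "cot_half t = sin t / (1 - cos t)"

lemma cot_half_measurable [measurable]: "cot_half \<in> borel_measurable borel"
  unfolding cot_half_def by measurable

text \<open>Turns the kernel on the line into a constant plus a geometric series in
  \<open>w\<close>, the form in which the moments enter. Multiplied by u - 1, with u =
  \<open>iexp t\<close>, numerator and denominator both acquire the factor z + i, and the quotient
  is i (1 + w u) / (1 - w u).\<close>

lemma iexp_cayley:
  assumes u: "iexp t \<noteq> 1" and z: "Im z > 0"
  defines "l \<equiv> complex_of_real (cot_half t)" and "w \<equiv> (z - \<i>) / (z + \<i>)"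
  shows "(1 + l * z) / (l - z) = - \<i> + 2 * \<i> / (1 - w * iexp t)"
proof -
  define u where "u = iexp t"
  have ue: "u = complex_of_real (cos t) + \<i> * complex_of_real (sin t)"
    by (simp add: u_def exp_Euler cos_of_real sin_of_real)
  have u1: "u - 1 \<noteq> 0" using u by (simp add: u_def)
  have c: "cos t \<noteq> 1"
  proof
    assume "cos t = 1"
    moreover from this have "sin t = 0" using sin_cos_squared_add[of t] by simp
    ultimately show False using u1 by (simp add: ue)
  qed
  have "sin t / (1 - cos t) * (cos t - 1) = - sin t" "sin t / (1 - cos t) * sin t = 1 + cos t"
    using c sin_squared_eq[of t] by (simp_all add: divide_simps power2_eq_square algebra_simps)
  \<comment> \<open>Equivalent to u = (l + i) / (l - i): the point \<open>l\<close> is the Cayley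
    preimage of \<open>u\<close>.\<close>
  hence lu: "l * (u - 1) = \<i> * (u + 1)"
    unfolding l_def ue cot_half_def by (simp add: complex_eq_iff)
  have n: "z + \<i> \<noteq> 0" using z by (auto simp: complex_eq_iff)
  hence w: "w * (z + \<i>) = z - \<i>" by (simp add: w_def)
  have lz: "l - z \<noteq> 0" using z by (auto simp: complex_eq_iff l_def)
  have "(l - z) * (u - 1) = (z + \<i>) - u * (w * (z + \<i>))"
    unfolding w using lu by (simp add: algebra_simps)
  hence 1: "(l - z) * (u - 1) = (z + \<i>) * (1 - w * u)" by (simp add: algebra_simps)
  hence wu: "1 - w * u \<noteq> 0" using lz u1 by auto
  have "(1 + l * z) * (u - 1) = (u - 1) + z * (l * (u - 1))" by (simp add: algebra_simps)
  also have "\<dots> = \<i> * (z + \<i>) + \<i> * u * (w * (z + \<i>))"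
    unfolding w lu by (simp add: algebra_simps)
  finally have 2: "(1 + l * z) * (u - 1) = \<i> * (1 + w * u) * (z + \<i>)" by (simp add: algebra_simps)
  have "(1 + l * z) / (l - z) = ((1 + l * z) * (u - 1)) / ((l - z) * (u - 1))" using u1 by simp
  also have "\<dots> = \<i> * (1 + w * u) / (1 - w * u)" unfolding 1 2 using n by simp
  also have "\<dots> = - \<i> + 2 * \<i> / (1 - w * u)" using wu
    by (simp add: divide_simps) (simp add: algebra_simps)
  finally show ?thesis by (simp add: u_def)
qed

section \<open>Integral representation of Q-functions\<close>

text \<open>A family of deficiency vectors of a self-adjoint extension \<open>G\<close> together with the
  Q-function that it generates.\<close>

locale gamma_field =
  fixes G :: "'a::complex_hilbert graph" and f :: "complex \<Rightarrow> 'a" and V :: "complex \<Rightarrow> complex"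
  assumes sa: "self_adjoint_in UNIV G"
    and f_diff: "Im z \<noteq> 0 \<Longrightarrow> Im w \<noteq> 0 \<Longrightarrow> (f z - f w, z *\<^sub>C f z - w *\<^sub>C f w) \<in> G"
    and kernel: "Im z \<noteq> 0 \<Longrightarrow> Im w \<noteq> 0 \<Longrightarrow> V z - cnj (V w) = (z - cnj w) * cinner (f z) (f w)"
    and f_nonzero: "f \<i> \<noteq> 0"
begin

section \<open>The Cayley transform and its moments\<close>

lemma lin_G: "cvec.subspace G"
  using sa by (simp add: self_adjoint_in_def linear_op_def)

text \<open>The Cayley transform $(G + i)(G - i)^{-1}$.\<close>

definition U :: "'a \<Rightarrow> 'a"
  where "U h = h + (2 * \<i>) *\<^sub>C (THE r. (r, h + \<i> *\<^sub>C r) \<in> G)"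

lemma U_eq: "(r, u) \<in> G \<Longrightarrow> U (u - \<i> *\<^sub>C r) = u + \<i> *\<^sub>C r"
proof -
  assume "(r, u) \<in> G"
  hence "(THE r'. (r', (u - \<i> *\<^sub>C r) + \<i> *\<^sub>C r') \<in> G) = r"
    using self_adjoint_resolvent[OF sa, of \<i> "u - \<i> *\<^sub>C r"] by (intro the1_equality) auto
  moreover have "(2 * \<i>) *\<^sub>C r = \<i> *\<^sub>C r + \<i> *\<^sub>C r"
    by (simp flip: scaleC_add_left)
  ultimately show ?thesis by (simp add: U_def)
qed

lemma U_cases: obtains r u where "(r, u) \<in> G" "h = u - \<i> *\<^sub>C r" "U h = u + \<i> *\<^sub>C r"
proof -
  obtain r where "(r, h + \<i> *\<^sub>C r) \<in> G"
    using self_adjoint_resolvent[OF sa, of \<i> h] by auto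
  with U_eq[OF this] that show ?thesis by simp
qed

lemma U_add: "U (h + k) = U h + U k"
proof -
  obtain r u where h: "(r, u) \<in> G" "h = u - \<i> *\<^sub>C r" "U h = u + \<i> *\<^sub>C r" by (rule U_cases)
  obtain s v where k: "(s, v) \<in> G" "k = v - \<i> *\<^sub>C s" "U k = v + \<i> *\<^sub>C s" by (rule U_cases)
  from U_eq[OF subspace_graph_add[OF lin_G h(1) k(1)]] show ?thesis
    unfolding h(3) k(3) by (simp add: h(2) k(2) scaleC_add_right add_diff_add ac_simps)
qed

lemma U_scale: "U (c *\<^sub>C h) = c *\<^sub>C U h"
proof -
  obtain r u where h: "(r, u) \<in> G" "h = u - \<i> *\<^sub>C r" "U h = u + \<i> *\<^sub>C r" by (rule U_cases)
  from U_eq[OF subspace_graph_scale[OF lin_G h(1)], of c] show ?thesis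
    unfolding h(3) by (simp add: h(2) scaleC_add_right cvec.scale_right_diff_distrib scaleC_scaleC
      mult.commute)
qed

text \<open>By symmetry of \<open>G\<close> the cross terms cancel in both inner products, leaving
  (u, v) + (r, s) on either side.\<close>

lemma cinner_U: "cinner (U h) (U k) = cinner h k"
proof -
  obtain r u where h: "(r, u) \<in> G" "h = u - \<i> *\<^sub>C r" "U h = u + \<i> *\<^sub>C r" by (rule U_cases)
  obtain s v where k: "(s, v) \<in> G" "k = v - \<i> *\<^sub>C s" "U k = v + \<i> *\<^sub>C s" by (rule U_cases)
  show ?thesis
    unfolding h(3) k(3) using self_adjoint_symmetric[OF sa h(1) k(1)]
    by (simp add: h(2) k(2) cinner_simps algebra_simps)
qed

lemma U_pow_add: "(U ^^ n) (h + k) = (U ^^ n) h + (U ^^ n) k"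
  by (induction n) (simp_all add: U_add)

lemma U_pow_scale: "(U ^^ n) (c *\<^sub>C h) = c *\<^sub>C (U ^^ n) h"
  by (induction n) (simp_all add: U_scale)

lemma norm_U_pow: "norm ((U ^^ n) h) = norm h"
  by (induction n) (simp_all add: norm_eq_sqrt_cinner cinner_U)

definition moment :: "nat \<Rightarrow> complex"
  where "moment n = cinner ((U ^^ n) (f \<i>)) (f \<i>)"

text \<open>In other words (1 - w U) f_z is a multiple of f_i, with w = (z - i)/(z + i), so that f_z
  will be a Neumann series in U.\<close>

lemma U_f:
  assumes "Im z > 0"
  shows "f z = (2 * \<i> / (z + \<i>)) *\<^sub>C f \<i> + ((z - \<i>) / (z + \<i>)) *\<^sub>C U (f z)"
proof (cases "z = \<i>")
  case True
  thus ?thesis by (simp add: scaleC_one)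
next
  case False
  have n: "z + \<i> \<noteq> 0" "z - \<i> \<noteq> 0" using assms False by (auto simp: complex_eq_iff)
  \<comment> \<open>Scaling \<open>f_diff\<close> at \<open>z\<close> and i by this factor gives a
    pair of \<open>G\<close> with u - i r = f_z, to which \<open>U_eq\<close> applies.\<close>
  define q where "q = 1 / (z - \<i>)"
  have q: "q * (z - \<i>) = 1" using n by (simp add: q_def)
  define r where "r = q *\<^sub>C (f z - f \<i>)"
  define u where "u = q *\<^sub>C (z *\<^sub>C f z - \<i> *\<^sub>C f \<i>)"
  have "(r, u) \<in> G"
    unfolding r_def u_def using assms by (intro subspace_graph_scale[OF lin_G] f_diff) auto
  note U = U_eq[OF this]
  have "u - \<i> *\<^sub>C r = (q * (z - \<i>)) *\<^sub>C f z"
    unfolding r_def u_def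
    by (simp add: cvec.scale_right_diff_distrib scaleC_scaleC cvec.scale_left_diff_distrib
      ring_distribs mult.commute)
  hence 1: "u - \<i> *\<^sub>C r = f z" by (simp add: q scaleC_one)
  have 2: "u + \<i> *\<^sub>C r = (q * (z + \<i>)) *\<^sub>C f z - (q * (2 * \<i>)) *\<^sub>C f \<i>"
  proof -
    have q: "q * (z + \<i>) = q * z + \<i> * q" "q * (2 * \<i>) = q * \<i> + \<i> * q"
      by (simp_all add: algebra_simps)
    show ?thesis
      unfolding r_def u_def q cvec.scale_right_diff_distrib scaleC_scaleC scaleC_add_left by simp
  qed
  have "((z - \<i>) / (z + \<i>)) *\<^sub>C U (f z) = f z - (2 * \<i> / (z + \<i>)) *\<^sub>C f \<i>"
    using U n unfolding 1 2
      by (simp add: cvec.scale_right_diff_distrib scaleC_scaleC q_def scaleC_one)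
  thus ?thesis by simp
qed

text \<open>Iterating \<open>U_f\<close> produces the partial sums and the remainder
  \<open>w ^ n * d n\<close>, which vanishes because U is isometric and |w| < 1.\<close>

lemma moment_sums:
  assumes z: "Im z > 0"
  shows "(\<lambda>k. ((z - \<i>) / (z + \<i>)) ^ k * moment k) sums (cinner (f z) (f \<i>) * (z + \<i>) / (2 * \<i>))"
proof -
  define w where "w = (z - \<i>) / (z + \<i>)"
  define g where "g = 2 * \<i> / (z + \<i>)"
  have n: "z + \<i> \<noteq> 0" using z by (auto simp: complex_eq_iff)
  hence g0: "g \<noteq> 0" by (simp add: g_def)
  define d where "d = (\<lambda>n. cinner ((U ^^ n) (f z)) (f \<i>))"
  have step: "d n = g * moment n + w * d (Suc n)" for n
  proof -
    have "(U ^^ n) (f z) = g *\<^sub>C (U ^^ n) (f \<i>) + w *\<^sub>C (U ^^ Suc n) (f z)"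
      by (subst U_f[OF z]) (simp only: U_pow_add U_pow_scale g_def w_def funpow_Suc_right o_apply)
    from arg_cong[OF this, of "\<lambda>x. cinner x (f \<i>)"] show ?thesis
      by (simp add: d_def moment_def cinner_simps)
  qed
  have ind: "d 0 = g * (\<Sum>k<n. w ^ k * moment k) + w ^ n * d n" for n
    by (induction n) (simp, subst (asm) step, simp add: algebra_simps)
  have w: "cmod w < 1" unfolding w_def by (rule cmod_cayley_less_1[OF z])
  have "(\<lambda>n. w ^ n * d n) \<longlonglongrightarrow> 0"
  proof (rule Lim_null_comparison)
    show "\<forall>\<^sub>F n in sequentially. norm (w ^ n * d n) \<le> cmod w ^ n * (norm (f z) * norm (f \<i>))"
      by (intro always_eventually allI)
        (auto simp: norm_mult norm_power d_def norm_U_pow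
          intro!: mult_left_mono order_trans[OF cmod_cinner_le])
    show "(\<lambda>n. cmod w ^ n * (norm (f z) * norm (f \<i>))) \<longlonglongrightarrow> 0"
      using w by (intro tendsto_mult_left_zero LIMSEQ_power_zero) simp
  qed
  hence "(\<lambda>n. (d 0 - w ^ n * d n) / g) \<longlonglongrightarrow> (d 0 - 0) / g"
    using g0 by (intro tendsto_intros)
  moreover have "(d 0 - w ^ n * d n) / g = (\<Sum>k<n. w ^ k * moment k)" for n
    using ind[of n] g0 by (simp add: field_simps)
  ultimately show ?thesis
    using n by (simp add: sums_def d_def g_def w_def)
qed

text \<open>The mean ergodic theorem for the Cayley transform: \<open>U - 1\<close> has dense range, as \<open>G\<close> is densely
  defined.\<close>

lemma moment_average:
  "(\<lambda>n. (\<Sum>k<Suc n. moment k) / of_nat (Suc n)) \<longlonglongrightarrow> 0"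
proof (rule LIMSEQ_I)
  fix e :: real assume e: "e > 0"
  let ?f = "f \<i>"
  have nf: "norm ?f > 0" using f_nonzero by simp
  have "?f \<in> closure (Domain G)" using sa by (auto simp: self_adjoint_in_def)
  moreover have "e / (2 * norm ?f) > 0" using e nf by simp
  ultimately obtain d v where d: "(d, v) \<in> G" "norm (?f - d) < e / (2 * norm ?f)"
    unfolding closure_approachable by (auto simp: dist_norm norm_minus_commute)
  \<comment> \<open>U - 1 sends v - i d to 2 i d, so this \<open>x\<close> solves (U - 1) x = d. The
    sums of \<open>(U ^^ k) d\<close> then telescope and stay bounded.\<close>
  define x where "x = (1 / (2 * \<i>)) *\<^sub>C (v - \<i> *\<^sub>C d)"
  have "U x = x + d"
  proof -
    have "x + d = (1 / (2 * \<i>)) *\<^sub>C ((v - \<i> *\<^sub>C d) + (2 * \<i>) *\<^sub>C d)"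
      by (simp add: x_def scaleC_add_right scaleC_scaleC scaleC_one)
    also have "(2 * \<i>) *\<^sub>C d = \<i> *\<^sub>C d + \<i> *\<^sub>C d" by (simp flip: scaleC_add_left)
    also have "(v - \<i> *\<^sub>C d) + (\<i> *\<^sub>C d + \<i> *\<^sub>C d) = v + \<i> *\<^sub>C d" by simp
    finally show ?thesis unfolding x_def U_scale U_eq[OF d(1)] ..
  qed
  hence Ux: "(U ^^ Suc k) x = (U ^^ k) x + (U ^^ k) d" for k
    by (simp only: funpow_Suc_right o_apply U_pow_add)
  have tel: "(\<Sum>k<n. (U ^^ k) d) = (U ^^ n) x - x" for n
    by (induction n) (use Ux in \<open>simp_all add: algebra_simps\<close>)
  have bound: "cmod (\<Sum>k<n. moment k) \<le> n * (e / 2) + 2 * norm x * norm ?f" for n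
  proof -
    have fd: "(U ^^ k) ?f = (U ^^ k) (?f - d) + (U ^^ k) d" for k
      by (simp flip: U_pow_add)
    have "(\<Sum>k<n. moment k) = (\<Sum>k<n. cinner ((U ^^ k) (?f - d)) ?f) + cinner ((U ^^ n) x - x) ?f"
      unfolding moment_def tel[symmetric] cinner_sum_left
      by (simp only: fd[of _] cinner_add_left sum.distrib)
    also have "cmod \<dots> \<le> (\<Sum>k<n. e / 2) + 2 * norm x * norm ?f"
    proof (intro norm_triangle_mono sum_norm_le)
      fix k
      have "cmod (cinner ((U ^^ k) (?f - d)) ?f) \<le> norm (?f - d) * norm ?f"
        using cmod_cinner_le[of "(U ^^ k) (?f - d)"] by (simp add: norm_U_pow)
      also have "\<dots> \<le> e / (2 * norm ?f) * norm ?f"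
        using d(2) by (intro mult_right_mono) auto
      finally show "cmod (cinner ((U ^^ k) (?f - d)) ?f) \<le> e / 2" using nf by simp
    next
      have "cmod (cinner ((U ^^ n) x - x) ?f) \<le> norm ((U ^^ n) x - x) * norm ?f"
        by (rule cmod_cinner_le)
      also have "norm ((U ^^ n) x - x) \<le> 2 * norm x"
        using norm_triangle_ineq4[of "(U ^^ n) x" x] by (simp add: norm_U_pow)
      finally show "cmod (cinner ((U ^^ n) x - x) ?f) \<le> 2 * norm x * norm ?f"
        by (simp add: mult_right_mono)
    qed
    finally show ?thesis by simp
  qed
  obtain N where N: "real N > 2 * norm x * norm ?f / (e / 2)" using reals_Archimedean2 by blast
  have "cmod ((\<Sum>k<Suc n. moment k) / of_nat (Suc n)) < e" if "n \<ge> N" for n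
  proof -
    have "real (Suc n) > 2 * norm x * norm ?f / (e / 2)" using N that by linarith
    hence "2 * norm x * norm ?f < Suc n * (e / 2)"
      using e by (subst (asm) pos_divide_less_eq) auto
    hence "cmod (\<Sum>k<Suc n. moment k) < Suc n * e" using bound[of "Suc n"] by (simp add: field_simps)
    thus ?thesis unfolding norm_divide norm_of_nat
      by (subst pos_divide_less_eq) (auto simp: mult.commute)
  qed
  thus "\<exists>no. \<forall>n\<ge>no. norm ((\<Sum>k<Suc n. moment k) / of_nat (Suc n) - 0) < e" by auto
qed

end

section \<open>From the moments to a measure on the line\<close>

context gamma_field
begin

lemma V_i: "V \<i> = complex_of_real (Re (V \<i>)) + \<i> * (norm (f \<i>))\<^sup>2"
  using kernel[of \<i> \<i>] by (simp add: cinner_self complex_eq_iff flip: of_real_power)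

lemma exists_moment_measure:
  obtains M where "real_distribution M" "\<And>n. char M (real n) = moment n / (norm (f \<i>))\<^sup>2"
proof -
  define c where "c = complex_of_real (1 / norm (f \<i>))"
  define g where "g = (\<lambda>n. c *\<^sub>C (U ^^ n) (f \<i>))"
  have "cinner (g (Suc m)) (g (Suc n)) = cinner (g m) (g n)" for m n
    by (simp add: g_def cinner_simps cinner_U)
  moreover have "norm (g 0) = 1" using f_nonzero by (simp add: g_def norm_scaleC c_def norm_divide)
  ultimately obtain M where M: "real_distribution M" "\<And>n. char M (real n) = cinner (g n) (g 0)"
    using herglotz_moments[of g] by blast
  have "cinner (g n) (g 0) = moment n / (norm (f \<i>))\<^sup>2" for n
    by (simp add: g_def cinner_simps moment_def c_def power2_eq_square)
  with M that show ?thesis by simp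
qed

lemma kernel_integral:
  fixes z :: complex
  assumes M: "real_distribution M" "\<And>n. char M (real n) = moment n / (norm (f \<i>))\<^sup>2"
    and z: "Im z \<noteq> 0"
  shows "V z = complex_of_real (Re (V \<i>)) + (norm (f \<i>))\<^sup>2 *
    (LINT t|M. (1 + cot_half t * z) / (cot_half t - z))"
proof -
  interpret real_distribution M by fact
  let ?a = "complex_of_real ((norm (f \<i>))\<^sup>2)" and ?Q = "complex_of_real (Re (V \<i>))"
  have a0: "?a \<noteq> 0" using f_nonzero by simp
  have "(\<lambda>n. (\<Sum>k<Suc n. moment k) / of_nat (Suc n) / ?a) \<longlonglongrightarrow> 0 / ?a"
    by (intro tendsto_divide moment_average tendsto_const a0)
  hence "(\<lambda>n. (\<Sum>k<Suc n. char M (real k)) / of_nat (Suc n)) \<longlonglongrightarrow> 0"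
    unfolding M(2) sum_divide_distrib[symmetric]
      by (simp only: divide_divide_eq_left mult.commute div_0)
  from AE_iexp_neq_1[OF M(1) this] have ae: "AE t in M. iexp t \<noteq> 1" .
  have upper: "V z = ?Q + ?a * (LINT t|M. (1 + cot_half t * z) / (cot_half t - z))"
    if z: "Im z > 0" for z :: complex
  proof -
    define w where "w = (z - \<i>) / (z + \<i>)"
    have w: "cmod w < 1" unfolding w_def by (rule cmod_cayley_less_1[OF z])
    let ?I = "LINT t|M. 1 / (1 - w * iexp t)"
    have i: "integrable M (\<lambda>t. 1 / (1 - w * iexp t))"
    proof (rule integrable_bounded[where B = "1 / (1 - cmod w)"])
      fix t
      have "1 - cmod w \<le> cmod (1 - w * iexp t)"
        using norm_triangle_ineq2[of 1 "w * iexp t"] by (simp add: norm_mult)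
      thus "cmod (1 / (1 - w * iexp t)) \<le> 1 / (1 - cmod w)"
        unfolding norm_divide norm_one using w by (intro frac_le) auto
    qed simp
    have "(\<lambda>k. ?a * (w ^ k * char M (real k))) sums (?a * ?I)"
      by (intro sums_mult char_power_series M(1) w)
    moreover have "?a * (w ^ k * char M (real k)) = w ^ k * moment k" for k
      using a0 by (simp add: M(2))
    ultimately have "(\<lambda>k. w ^ k * moment k) sums (?a * ?I)" by (simp only:)
    from sums_unique2[OF moment_sums[OF z, folded w_def] this]
    have I: "cinner (f z) (f \<i>) * (z + \<i>) / (2 * \<i>) = ?a * ?I" .
    \<comment> \<open>The kernel identity with second point i; its inner product has just been
      identified with an integral.\<close>
    have "V z = cnj (V \<i>) + cinner (f z) (f \<i>) * (z + \<i>)"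
      using kernel[of z \<i>] z by (simp add: algebra_simps)
    also have "cinner (f z) (f \<i>) * (z + \<i>) = 2 * \<i> * (cinner (f z) (f \<i>) * (z + \<i>) / (2 * \<i>))"
      by simp
    also have "cnj (V \<i>) = ?Q - \<i> * ?a" by (subst V_i) simp
    finally have "V z = ?Q + ?a * (- \<i> + 2 * \<i> * ?I)"
      unfolding I by (simp add: algebra_simps)
    also have "- \<i> + 2 * \<i> * ?I = (LINT t|M. - \<i> + 2 * \<i> * (1 / (1 - w * iexp t)))"
    proof -
      have "integrable M (\<lambda>t. 2 * \<i> * (1 / (1 - w * iexp t)))" by (intro integrable_mult_right i)
      from Bochner_Integration.integral_add[OF integrable_const this, of "- \<i>"] show ?thesis
        unfolding integral_mult_right_zero lebesgue_integral_const prob_space by simp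
    qed
    also have "\<dots> = (LINT t|M. (1 + cot_half t * z) / (cot_half t - z))"
    proof (rule integral_cong_AE)
      show "AE t in M. - \<i> + 2 * \<i> * (1 / (1 - w * iexp t)) =
        (1 + cot_half t * z) / (cot_half t - z)"
        using ae by eventually_elim (simp add: iexp_cayley[OF _ z] w_def)
    qed measurable
    finally show ?thesis .
  qed
  show ?thesis
  proof (cases "Im z > 0")
    case True
    thus ?thesis by (rule upper)
  next
    case False
    \<comment> \<open>For the pair \<open>z\<close>, \<open>cnj z\<close> the factor in the kernel
      identity is zero, which is the reflection symmetry of V.\<close>
    hence z': "Im (cnj z) > 0" using z by simp
    have "V z = cnj (V (cnj z))" using kernel[of z "cnj z"] z by simp
    also have "V (cnj z) = ?Q + ?a * (LINT t|M. (1 + cot_half t * cnj z) / (cot_half t - cnj z))"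
      by (rule upper[OF z'])
    also have "cnj \<dots> = ?Q + ?a * cnj (LINT t|M. (1 + cot_half t * cnj z) / (cot_half t - cnj z))"
      unfolding complex_cnj_add complex_cnj_mult complex_cnj_complex_of_real ..
    also have "cnj (LINT t|M. (1 + cot_half t * cnj z) / (cot_half t - cnj z)) =
        (LINT t|M. cnj ((1 + cot_half t * cnj z) / (cot_half t - cnj z)))"
      by (rule Bochner_Integration.integral_cnj[symmetric])
    finally show ?thesis
      unfolding complex_cnj_divide complex_cnj_add complex_cnj_diff
        complex_cnj_mult complex_cnj_complex_of_real complex_cnj_cnj complex_cnj_one .
  qed
qed

lemma nevanlinna_representation:
  obtains \<mu> where "sets \<mu> = sets borel"
    "has_bochner_integral \<mu> (\<lambda>t. 1 / (1 + t\<^sup>2)) ((norm (f \<i>))\<^sup>2)"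
    "\<And>z. Im z \<noteq> 0 \<Longrightarrow> V z = complex_of_real (Re (V \<i>)) +
        (LINT t|\<mu>. 1 / (complex_of_real t - z) - complex_of_real (t / (1 + t\<^sup>2)))"
proof -
  obtain M where M: "real_distribution M" "\<And>n. char M (real n) = moment n / (norm (f \<i>))\<^sup>2"
    using exists_moment_measure by blast
  interpret real_distribution M by fact
  let ?a = "(norm (f \<i>))\<^sup>2"
  \<comment> \<open>With t now on the line, the density turns the kernel (1 + t z) / (t - z) into 1
    / (t - z) - t / (1 + t^2), and the integral of 1 / (1 + t^2) into \<open>?a\<close> times the
    total mass one.\<close>
  define \<mu> where "\<mu> = density (distr M borel cot_half) (\<lambda>t. ennreal (?a * (1 + t\<^sup>2)))"
  have pos: "1 + t\<^sup>2 > 0" for t :: real by (simp add: add_pos_nonneg)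
  show ?thesis
  proof (rule that[of \<mu>])
    show "sets \<mu> = sets borel" by (simp add: \<mu>_def)
    have "has_bochner_integral M (\<lambda>t. ?a) (measure M (space M) *\<^sub>R ?a)"
      by (simp add: has_bochner_integral_iff)
    moreover have "(?a * (1 + t\<^sup>2)) *\<^sub>R (1 / (1 + t\<^sup>2)) = ?a" for t :: real
      using pos[of t] by simp
    ultimately have "has_bochner_integral M
        (\<lambda>t. (?a * (1 + (cot_half t)\<^sup>2)) *\<^sub>R (1 / (1 + (cot_half t)\<^sup>2))) ?a"
      by (simp only: prob_space scaleR_one)
    thus "has_bochner_integral \<mu> (\<lambda>t. 1 / (1 + t\<^sup>2)) ?a"
      unfolding \<mu>_def
      by (intro has_bochner_integral_density has_bochner_integral_distr AE_I2) auto
  next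
    fix z :: complex assume z: "Im z \<noteq> 0"
    have "(LINT t|\<mu>. 1 / (complex_of_real t - z) - complex_of_real (t / (1 + t\<^sup>2))) =
      (LINT t|M. (?a * (1 + (cot_half t)\<^sup>2)) *\<^sub>R
        (1 / (complex_of_real (cot_half t) - z) - complex_of_real (cot_half t / (1 +
          (cot_half t)\<^sup>2))))"
      unfolding \<mu>_def by (subst integral_density) (auto simp: integral_distr)
    also have "\<dots> = (LINT t|M. ?a * ((1 + cot_half t * z) / (cot_half t - z)))"
    proof (intro Bochner_Integration.integral_cong refl)
      fix t
      define l where "l = cot_half t"
      have "complex_of_real l - z \<noteq> 0" using z by (auto simp: complex_eq_iff)
      moreover have "1 + complex_of_real l ^ 2 \<noteq> 0"
        using pos[of l] by (metis of_real_1 of_real_add of_real_eq_0_iff of_real_power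
          order_less_irrefl)
      ultimately have "(1 + complex_of_real l ^ 2) * (1 / (l - z) - l / (1 +
        complex_of_real l ^ 2)) = (1 + l * z) / (l - z)"
        by (simp add: divide_simps) (simp add: algebra_simps power2_eq_square)
      thus "(?a * (1 + (cot_half t)\<^sup>2)) *\<^sub>R
        (1 / (complex_of_real (cot_half t) - z) - complex_of_real (cot_half t / (1 +
          (cot_half t)\<^sup>2)))
        = ?a * ((1 + cot_half t * z) / (cot_half t - z))"
        by (simp add: scaleR_conv_of_real l_def mult.assoc)
    qed
    also have "\<dots> = ?a * (LINT t|M. (1 + cot_half t * z) / (cot_half t - z))"
      by (rule integral_mult_right_zero)
    finally show "V z = complex_of_real (Re (V \<i>)) +
        (LINT t|\<mu>. 1 / (complex_of_real t - z) - complex_of_real (t / (1 + t\<^sup>2)))"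
      using kernel_integral[OF M z] by simp
  qed
qed

text \<open>The kernel identity at z = w = iy expresses |f_z|^2 as the integral of 1 / (t^2 + y^2),
  at most the total mass over y^2. This is the decay that \<open>gamma_no_decay\<close>
  excludes.\<close>

lemma finite_measure_decay:
  assumes sets: "sets \<mu> = sets borel" and fin: "emeasure \<mu> UNIV \<noteq> \<infinity>" and y: "y > 0"
    and V: "\<And>z. Im z \<noteq> 0 \<Longrightarrow> V z = complex_of_real Q +
        (LINT t|\<mu>. 1 / (complex_of_real t - z) - complex_of_real (t / (1 + t\<^sup>2)))"
  shows "y * norm (f (\<i> * of_real y)) \<le> sqrt (measure \<mu> UNIV)"
proof -
  have [measurable_cong]: "sets \<mu> = sets borel" by (fact sets)
  have sp: "space \<mu> = UNIV" using sets_eq_imp_space_eq[OF sets] by simp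
  interpret finite_measure \<mu> using fin by (intro finite_measureI) (simp add: sp)
  define z where "z = \<i> * complex_of_real y"
  have z: "Im z \<noteq> 0" using y by (simp add: z_def)
  have lz: "complex_of_real t - z \<noteq> 0" for t using z by (auto simp: complex_eq_iff)
  define F where "F = (\<lambda>t. 1 / (complex_of_real t - z) - complex_of_real (t / (1 + t\<^sup>2)))"
  have ge: "y \<le> cmod (complex_of_real t - z)" for t
    using abs_Im_le_cmod[of "complex_of_real t - z"] y by (simp add: z_def)
  \<comment> \<open>Integrability of \<open>F\<close>, supplied by finiteness of the measure,
    permits merging the two integrals of V z - \<open>cnj (V z)\<close>.\<close>
  have iF: "integrable \<mu> F"
  proof (rule integrable_const_bound[where B = "1 / y + 1"])
    show "AE t in \<mu>. norm (F t) \<le> 1 / y + 1"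
    proof (rule AE_I2)
      fix t :: real
      have "\<bar>t / (1 + t\<^sup>2)\<bar> \<le> 1"
      proof -
        have "0 \<le> (\<bar>t\<bar> - 1)\<^sup>2" by simp
        hence "2 * \<bar>t\<bar> \<le> 1 + t\<^sup>2" by (simp add: power2_diff)
        hence "\<bar>t\<bar> \<le> 1 + t\<^sup>2" by linarith
        thus ?thesis by (simp add: abs_divide divide_le_eq_1 add_pos_nonneg)
      qed
      moreover have "cmod (1 / (complex_of_real t - z)) \<le> 1 / y"
        unfolding norm_divide norm_one using ge[of t] y by (intro frac_le) auto
      moreover have "norm (F t) \<le> cmod (1 / (complex_of_real t - z)) + \<bar>t / (1 + t\<^sup>2)\<bar>"
        unfolding F_def using norm_triangle_ineq4 norm_of_real by metis
      ultimately show "norm (F t) \<le> 1 / y + 1" by linarith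
    qed
    show "F \<in> borel_measurable \<mu>" unfolding F_def by measurable
  qed
  have VF: "V z = complex_of_real Q + (LINT t|\<mu>. F t)" unfolding F_def by (rule V[OF z])
  have "(2 * z) * (norm (f z))\<^sup>2 = V z - cnj (V z)"
    using kernel[OF z z] by (simp add: cinner_self z_def)
  also have "\<dots> = (LINT t|\<mu>. F t) - (LINT t|\<mu>. cnj (F t))"
    unfolding VF by simp
  also have "\<dots> = (LINT t|\<mu>. F t - cnj (F t))"
    using iF by (intro Bochner_Integration.integral_diff[symmetric]) auto
  also have "\<dots> = (LINT t|\<mu>. (2 * z) * complex_of_real (1 / (t\<^sup>2 + y\<^sup>2)))"
  proof (intro Bochner_Integration.integral_cong refl)
    fix t
    have c: "cnj z = - z" by (simp add: z_def)
    have "(complex_of_real t - z) * (complex_of_real t + z) = complex_of_real (t\<^sup>2 + y\<^sup>2)"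
      by (simp add: z_def complex_eq_iff power2_eq_square)
    moreover have "complex_of_real t + z \<noteq> 0" using z by (auto simp: complex_eq_iff)
    hence "F t - cnj (F t) = (2 * z) / ((complex_of_real t - z) * (complex_of_real t + z))"
      using lz[of t] by (simp add: F_def c) (simp add: divide_simps)
    ultimately show "F t - cnj (F t) = (2 * z) * complex_of_real (1 / (t\<^sup>2 + y\<^sup>2))" by simp
  qed
  also have "\<dots> = (2 * z) * complex_of_real (LINT t|\<mu>. 1 / (t\<^sup>2 + y\<^sup>2))"
    unfolding integral_mult_right_zero integral_complex_of_real ..
  finally have "complex_of_real ((norm (f z))\<^sup>2) = complex_of_real (LINT t|\<mu>. 1 / (t\<^sup>2 + y\<^sup>2))"
    using z by (subst (asm) mult_cancel_left) auto
  hence "(norm (f z))\<^sup>2 = (LINT t|\<mu>. 1 / (t\<^sup>2 + y\<^sup>2))" by (simp only: of_real_eq_iff)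
  also have "\<dots> \<le> (LINT t|\<mu>. 1 / y\<^sup>2)"
  proof (rule integral_mono)
    show "1 / (t\<^sup>2 + y\<^sup>2) \<le> 1 / y\<^sup>2" for t using y by (intro frac_le) auto
    thus "integrable \<mu> (\<lambda>t. 1 / (t\<^sup>2 + y\<^sup>2))"
      by (intro integrable_const_bound[where B = "1 / y\<^sup>2"]) auto
  qed simp
  also have "\<dots> = measure \<mu> UNIV / y\<^sup>2" by (simp add: sp)
  finally have "(y * norm (f z))\<^sup>2 \<le> measure \<mu> UNIV"
    using y by (simp add: power_mult_distrib field_simps)
  thus ?thesis unfolding z_def by (rule real_le_rsqrt)
qed

end

section \<open>The von Neumann parameter\<close>

text \<open>At i the integrand is i / (1 + t^2). Hence V(i) determines \<open>Q\<close> and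
  \<open>a\<close>, which makes the three classes comparable.\<close>

lemma representing_measure_i:
  assumes "representing_measure Q a V \<mu>"
  shows "V \<i> = complex_of_real Q + \<i> * complex_of_real a"
proof -
  have a: "has_bochner_integral \<mu> (\<lambda>t. 1 / (1 + t\<^sup>2)) a"
    and V: "V \<i> = complex_of_real Q +
        (LINT t|\<mu>. 1 / (complex_of_real t - \<i>) - complex_of_real (t / (1 + t\<^sup>2)))"
    using assms by (auto simp: representing_measure_def)
  have "1 / (complex_of_real t - \<i>) - complex_of_real (t / (1 + t\<^sup>2)) =
    \<i> * complex_of_real (1 / (1 + t\<^sup>2))"
    for t :: real
  proof -
    have "complex_of_real t - \<i> \<noteq> 0" "complex_of_real t + \<i> \<noteq> 0" by (auto simp: complex_eq_iff)
    moreover have "complex_of_real (1 + t\<^sup>2) = (complex_of_real t - \<i>) * (complex_of_real t + \<i>)"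
      by (simp add: algebra_simps power2_eq_square)
    ultimately show ?thesis unfolding of_real_divide by (simp add: divide_simps)
  qed
  hence "V \<i> = complex_of_real Q + (LINT t|\<mu>. \<i> * complex_of_real (1 / (1 + t\<^sup>2)))"
    using V by (simp only:)
  also have "(LINT t|\<mu>. \<i> * complex_of_real (1 / (1 + t\<^sup>2))) = \<i> * complex_of_real a"
    unfolding integral_mult_right_zero integral_complex_of_real
    using a by (simp add: has_bochner_integral_integral_eq)
  finally show ?thesis .
qed

text \<open>With $p = (1-a)^2 + Q^2$ and $q = (1+a)^2 + Q^2$ one has $b^2 + 4Q^2 = pq$, so that the square
  root in the formulas is \<open>\<kappa> q\<close>.\<close>

lemma kappa_formulas:
  fixes a Q \<kappa> b s :: real
  assumes a: "a > 0" and Q: "Q \<noteq> 0" and \<kappa>: "\<kappa> \<ge> 0"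
    and eq: "\<kappa>\<^sup>2 * ((1 + a)\<^sup>2 + Q\<^sup>2) = (1 - a)\<^sup>2 + Q\<^sup>2"
    and b: "b = Q\<^sup>2 + a\<^sup>2 - 1" and s: "s = sqrt (b\<^sup>2 + 4 * Q\<^sup>2)"
  shows "\<kappa> = ((b - 2 * Q\<^sup>2 - s)\<^sup>2 - a * (b - s)\<^sup>2 + 4 * Q\<^sup>2 * a * (a - 1)) /
      ((b - 2 * Q\<^sup>2 - s)\<^sup>2 + a * (b - s)\<^sup>2 + 4 * Q\<^sup>2 * a * (a + 1))" (is "_ = ?N2 / ?D2")
    and "\<kappa> = (a * (b + s)\<^sup>2 - (b - 2 * Q\<^sup>2 + s)\<^sup>2 - 4 * Q\<^sup>2 * a * (a - 1)) /
      ((b - 2 * Q\<^sup>2 + s)\<^sup>2 + a * (b + s)\<^sup>2 + 4 * Q\<^sup>2 * a * (a + 1))" (is "_ = ?N3 / ?D3")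
proof -
  define q where "q = (1 + a)\<^sup>2 + Q\<^sup>2"
  have q: "q > 0" using a by (simp add: q_def add_pos_nonneg)
  have s2: "s\<^sup>2 = b\<^sup>2 + 4 * Q\<^sup>2" by (simp add: s)
  have pq: "b\<^sup>2 + 4 * Q\<^sup>2 = ((1 - a)\<^sup>2 + Q\<^sup>2) * q"
    unfolding b q_def by algebra
  have "s = \<kappa> * q"
  proof -
    have "b\<^sup>2 + 4 * Q\<^sup>2 = (\<kappa> * q)\<^sup>2"
      unfolding pq eq[folded q_def, symmetric] by (simp add: power2_eq_square)
    hence "s = sqrt ((\<kappa> * q)\<^sup>2)" unfolding s by (rule arg_cong)
    thus ?thesis using q \<kappa> by simp
  qed
  hence k: "\<kappa> = s / q" using q by simp
  have pos: "4 * Q\<^sup>2 * a * (a + 1) > 0" using a Q by simp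
  have D: "?D2 > 0" "?D3 > 0"
    using a by (intro add_nonneg_pos pos add_nonneg_nonneg mult_nonneg_nonneg; simp)+
  \<comment> \<open>Cross-multiplied, both formulas are polynomial identities modulo
    \<open>s2\<close>; the positive denominators allow dividing back.\<close>
  have "?N2 * q = s * ?D2" "?N3 * q = s * ?D3"
    using s2 unfolding b q_def by algebra+
  with D q show "\<kappa> = ?N2 / ?D2" "\<kappa> = ?N3 / ?D3"
    unfolding k by (simp_all add: frac_eq_eq mult.commute)
qed

sublocale l_system \<subseteq> gamma_field G gamma "impedance A X K"
  by unfold_locales (simp_all add: sa gamma_diff impedance_kernel gamma_nonzero)

context l_system
begin

lemma exists_representing_measure:
  "\<exists>\<mu>. representing_measure (Re (impedance A X K \<i>)) ((norm (gamma \<i>))\<^sup>2) (impedance A X K) \<mu>"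
proof -
  obtain \<mu> where \<mu>: "sets \<mu> = sets borel"
    "has_bochner_integral \<mu> (\<lambda>t. 1 / (1 + t\<^sup>2)) ((norm (gamma \<i>))\<^sup>2)"
    "\<And>z. Im z \<noteq> 0 \<Longrightarrow> impedance A X K z = complex_of_real (Re (impedance A X K \<i>)) +
        (LINT t|\<mu>. 1 / (complex_of_real t - z) - complex_of_real (t / (1 + t\<^sup>2)))"
    using nevanlinna_representation by blast
  have "emeasure \<mu> UNIV = \<infinity>"
    using finite_measure_decay[OF \<mu>(1) _ _ \<mu>(3)] gamma_no_decay by blast
  with \<mu> show ?thesis unfolding representing_measure_def by blast
qed

end

theorem theorem28:
  fixes A T :: "'a::complex_hilbert graph"
    and X :: "'a \<Rightarrow> 'a \<Rightarrow> complex"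
    and K :: "complex \<Rightarrow> 'a \<Rightarrow> complex"
    and \<kappa> :: real
  assumes "minimal_L_system A T X K"
    and "von_Neumann_parameter A T (complex_of_real \<kappa>)"
    and "0 \<le> \<kappa>" and "\<kappa> < 1"
  shows "let V = impedance A X K;
      P1 = (\<exists>Q. V \<in> class_M Q \<and> \<kappa> = \<bar>Q\<bar> / sqrt (Q\<^sup>2 + 4));
      P2 = (\<exists>Q \<kappa>\<^sub>0. 0 < \<kappa>\<^sub>0 \<and> \<kappa>\<^sub>0 < 1 \<and> V \<in> class_M_kappa \<kappa>\<^sub>0 Q \<and>
        (let a = (1 - \<kappa>\<^sub>0) / (1 + \<kappa>\<^sub>0); b = Q\<^sup>2 + a\<^sup>2 - 1 in
          \<kappa> = (if Q = 0 then \<kappa>\<^sub>0 else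
            ((b - 2 * Q\<^sup>2 - sqrt (b\<^sup>2 + 4 * Q\<^sup>2))\<^sup>2
              - a * (b - sqrt (b\<^sup>2 + 4 * Q\<^sup>2))\<^sup>2 + 4 * Q\<^sup>2 * a * (a - 1)) /
            ((b - 2 * Q\<^sup>2 - sqrt (b\<^sup>2 + 4 * Q\<^sup>2))\<^sup>2
              + a * (b - sqrt (b\<^sup>2 + 4 * Q\<^sup>2))\<^sup>2 + 4 * Q\<^sup>2 * a * (a + 1)))));
      P3 = (\<exists>Q \<kappa>\<^sub>0. 0 < \<kappa>\<^sub>0 \<and> \<kappa>\<^sub>0 < 1 \<and> V \<in> class_M_kappa_inv \<kappa>\<^sub>0 Q \<and>
        (let a = (1 + \<kappa>\<^sub>0) / (1 - \<kappa>\<^sub>0); b = Q\<^sup>2 + a\<^sup>2 - 1 in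
          \<kappa> = (if Q = 0 then \<kappa>\<^sub>0 else
            (a * (b + sqrt (b\<^sup>2 + 4 * Q\<^sup>2))\<^sup>2
              - (b - 2 * Q\<^sup>2 + sqrt (b\<^sup>2 + 4 * Q\<^sup>2))\<^sup>2 - 4 * Q\<^sup>2 * a * (a - 1)) /
            ((b - 2 * Q\<^sup>2 + sqrt (b\<^sup>2 + 4 * Q\<^sup>2))\<^sup>2
              + a * (b + sqrt (b\<^sup>2 + 4 * Q\<^sup>2))\<^sup>2 + 4 * Q\<^sup>2 * a * (a + 1)))))
    in (P1 \<and> \<not> P2 \<and> \<not> P3) \<or> (\<not> P1 \<and> P2 \<and> \<not> P3) \<or> (\<not> P1 \<and> \<not> P2 \<and> P3)"
proof -
  interpret l_system A T X K
    using assms(1) by unfold_locales (simp add: minimal_L_system_def)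
  define V where "V = impedance A X K"
  define Q where "Q = Re (V \<i>)"
  define a where "a = (norm (gamma \<i>))\<^sup>2"
  have Vi: "V \<i> = complex_of_real Q + \<i> * complex_of_real a"
    unfolding V_def Q_def a_def by (rule V_i)
  have a0: "a > 0" using gamma_nonzero[of \<i>] by (simp add: a_def)
  have rep: "\<exists>\<mu>. representing_measure Q a V \<mu>"
    using exists_representing_measure by (simp add: V_def Q_def a_def)
  have unique: "Q' = Q \<and> a' = a" if "representing_measure Q' a' V \<mu>" for Q' a' \<mu>
    using representing_measure_i[OF that] Vi by (simp add: complex_eq_iff)
  have "cmod (1 + \<i> * V \<i>) = \<kappa> * cmod (1 + \<i> * cnj (V \<i>))"
    using von_Neumann_parameter_impedance[OF assms(2)] assms(3) by (simp add: V_def)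
  \<comment> \<open>With V(i) = Q + i a the two numbers are 1 - a + i Q and 1 + a + i Q.\<close>
  hence "(cmod (1 + \<i> * V \<i>))\<^sup>2 = \<kappa>\<^sup>2 * (cmod (1 + \<i> * cnj (V \<i>)))\<^sup>2"
    by (simp add: power_mult_distrib)
  hence eq: "\<kappa>\<^sup>2 * ((1 + a)\<^sup>2 + Q\<^sup>2) = (1 - a)\<^sup>2 + Q\<^sup>2"
    by (simp add: Vi cmod_power2)
  note formulas = kappa_formulas[OF a0 _ assms(3) eq refl refl]
  have zero: "\<kappa> = \<bar>1 - a\<bar> / (1 + a)" if "Q = 0"
  proof -
    have "(\<kappa> * (1 + a))\<^sup>2 = \<bar>1 - a\<bar>\<^sup>2" using eq that by (simp add: power_mult_distrib)
    hence "\<kappa> * (1 + a) = \<bar>1 - a\<bar>" using assms(3) a0 by (subst (asm) power2_eq_iff_nonneg) auto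
    thus ?thesis using a0 by (simp add: field_simps)
  qed
  define P1 where "P1 = (\<exists>Q. V \<in> class_M Q \<and> \<kappa> = \<bar>Q\<bar> / sqrt (Q\<^sup>2 + 4))"
  define F2 where "F2 = (\<lambda>Q \<kappa>\<^sub>0. let a = (1 - \<kappa>\<^sub>0) / (1 + \<kappa>\<^sub>0); b = Q\<^sup>2 + a\<^sup>2 - 1 in
          \<kappa> = (if Q = 0 then \<kappa>\<^sub>0 else
            ((b - 2 * Q\<^sup>2 - sqrt (b\<^sup>2 + 4 * Q\<^sup>2))\<^sup>2
              - a * (b - sqrt (b\<^sup>2 + 4 * Q\<^sup>2))\<^sup>2 + 4 * Q\<^sup>2 * a * (a - 1)) /
            ((b - 2 * Q\<^sup>2 - sqrt (b\<^sup>2 + 4 * Q\<^sup>2))\<^sup>2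
              + a * (b - sqrt (b\<^sup>2 + 4 * Q\<^sup>2))\<^sup>2 + 4 * Q\<^sup>2 * a * (a + 1))))"
  define F3 where "F3 = (\<lambda>Q \<kappa>\<^sub>0. let a = (1 + \<kappa>\<^sub>0) / (1 - \<kappa>\<^sub>0); b = Q\<^sup>2 + a\<^sup>2 - 1 in
          \<kappa> = (if Q = 0 then \<kappa>\<^sub>0 else
            (a * (b + sqrt (b\<^sup>2 + 4 * Q\<^sup>2))\<^sup>2
              - (b - 2 * Q\<^sup>2 + sqrt (b\<^sup>2 + 4 * Q\<^sup>2))\<^sup>2 - 4 * Q\<^sup>2 * a * (a - 1)) /
            ((b - 2 * Q\<^sup>2 + sqrt (b\<^sup>2 + 4 * Q\<^sup>2))\<^sup>2
              + a * (b + sqrt (b\<^sup>2 + 4 * Q\<^sup>2))\<^sup>2 + 4 * Q\<^sup>2 * a * (a + 1))))"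
  define P2 where "P2 = (\<exists>Q \<kappa>\<^sub>0. 0 < \<kappa>\<^sub>0 \<and> \<kappa>\<^sub>0 < 1 \<and> V \<in> class_M_kappa \<kappa>\<^sub>0 Q \<and> F2 Q \<kappa>\<^sub>0)"
  define P3 where "P3 = (\<exists>Q \<kappa>\<^sub>0. 0 < \<kappa>\<^sub>0 \<and> \<kappa>\<^sub>0 < 1 \<and> V \<in> class_M_kappa_inv \<kappa>\<^sub>0 Q \<and> F3 Q \<kappa>\<^sub>0)"
  \<comment> \<open>Class membership alone fixes the position of \<open>a\<close> relative to 1, so
    exclusivity is the trichotomy of the order.\<close>
  have P1_imp: "a = 1" if P1
    using that unique by (auto simp: P1_def class_M_def)
  have P2_imp: "a < 1" if P2
  proof -
    from that obtain Q' k \<mu> where "0 < k" "representing_measure Q' ((1 - k) / (1 + k)) V \<mu>"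
      by (auto simp: P2_def class_M_kappa_def)
    with unique[OF this(2)] show ?thesis by auto
  qed
  have P3_imp: "a > 1" if P3
  proof -
    from that obtain Q' k \<mu> where "0 < k" "k < 1" "representing_measure Q' ((1 + k) / (1 - k)) V \<mu>"
      by (auto simp: P3_def class_M_kappa_inv_def)
    with unique[OF this(3)] show ?thesis by auto
  qed
  have P1 if a1: "a = 1"
  proof -
    have "(\<kappa> * sqrt (Q\<^sup>2 + 4))\<^sup>2 = \<bar>Q\<bar>\<^sup>2" using eq by (simp add: a1 power_mult_distrib add.commute)
    hence "\<kappa> * sqrt (Q\<^sup>2 + 4) = \<bar>Q\<bar>"
      using assms(3) by (subst (asm) power2_eq_iff_nonneg) auto
    moreover have "sqrt (Q\<^sup>2 + 4) > 0" by (simp add: add_nonneg_pos)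
    ultimately have "\<kappa> = \<bar>Q\<bar> / sqrt (Q\<^sup>2 + 4)" by (simp add: field_simps)
    moreover have "V \<in> class_M Q" using rep by (simp add: class_M_def a1)
    ultimately show ?thesis unfolding P1_def by blast
  qed
  moreover have P2 if a1: "a < 1"
  proof -
    \<comment> \<open>The map k to (1 - k) / (1 + k) is its own inverse.\<close>
    define k where "k = (1 - a) / (1 + a)"
    have k: "0 < k" "k < 1" "(1 - k) / (1 + k) = a"
      using a0 a1 by (auto simp: k_def field_simps)
    have "V \<in> class_M_kappa k Q" using rep by (simp add: class_M_kappa_def k)
    moreover have "F2 Q k"
      unfolding F2_def Let_def k(3) using zero formulas(1) a1 by (simp add: k_def)
    ultimately show ?thesis unfolding P2_def using k by blast
  qed
  moreover have P3 if a1: "a > 1"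
  proof -
    \<comment> \<open>Solves (1 + k) / (1 - k) = a for k.\<close>
    define k where "k = (a - 1) / (1 + a)"
    have k: "0 < k" "k < 1" "(1 + k) / (1 - k) = a"
      using a0 a1 by (auto simp: k_def field_simps)
    have "V \<in> class_M_kappa_inv k Q" using rep by (simp add: class_M_kappa_inv_def k)
    moreover have "F3 Q k"
      unfolding F3_def Let_def k(3) using zero formulas(2) a1 by (simp add: k_def)
    ultimately show ?thesis unfolding P3_def using k by blast
  qed
  ultimately have "(P1 \<and> \<not> P2 \<and> \<not> P3) \<or> (\<not> P1 \<and> P2 \<and> \<not> P3) \<or> (\<not> P1 \<and> \<not> P2 \<and> P3)"
    using P1_imp P2_imp P3_imp by (metis linorder_less_linear order_less_asym order_less_irrefl)
  thus ?thesis
    unfolding Let_def P1_def P2_def P3_def F2_def F3_def V_def .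
qed

end
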